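(* Let $q>1$, $1<s<q'$, $\alpha>-1$, $u\in H(\mathbb{R}^2_+)$, let $\varphi:\mathbb{R}^2_+\to\mathbb{R}^2_+$ be a holomorphic self-mapping, and let $\omega$ be a weight with $\omega^{s'}\in\mathbf{B}^{\alpha,q}_{u,\varphi}$, where $q'$ and $s'$ are the conjugate exponents of $q$ and $s$. Suppose further that $W_{u,\varphi}:A^q_\alpha\to A^q_\alpha$ is bounded. Then there is a constant $C>0$, independent of $f$ and of the weight $\omega$, such that for all $f\in A^q_\alpha$, $$\int_{\mathbb{R}^2_+}|u(z)|^q|f(\varphi(z))|^q\omega(z)\,dA_\alpha(z)\le C\,\left[\omega^{s'}\right]_{\mathbf{B}^{\alpha,q}_{u,\varphi}}^{\frac1{s'}}\|f\|_{q,\alpha}^q.$$ In particular, the measure $\mu_{u,\varphi,q,\omega,\alpha}$ on $\mathbb{R}^2_+$ defined by $$\int_{\mathbb{R}^2_+}g\,d\mu_{u,\varphi,q,\omega,\alpha}=\int_{\mathbb{R}^2_+}|u(z)|^q\,g(\varphi(z))\,\omega(z)\,dA_\alpha(z),\qquad g\text{ measurable},$$ is a $1$-Carleson measure.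
   Context: $\mathbb{R}^2_+=\{z\in\mathbb{C}:\operatorname{Im}z>0\}$ and $H(\mathbb{R}^2_+)$ is the set of holomorphic functions on $\mathbb{R}^2_+$. For $\alpha>-1$, $dA_\alpha(z)=\frac1\pi(\alpha+1)(2\operatorname{Im}z)^\alpha\,dx\,dy$ ($z=x+iy$), $A_\alpha(E)=\int_E dA_\alpha$, and for $0<p<\infty$, $\|f\|_{p,\alpha}=\left(\int_{\mathbb{R}^2_+}|f|^p\,dA_\alpha\right)^{1/p}$. The weighted Bergman space $A^p_\alpha$ is the set of $f\in H(\mathbb{R}^2_+)$ with $\|f\|_{p,\alpha}<\infty$. The weighted composition operator is $W_{u,\varphi}f(z)=u(z)f(\varphi(z))$; it is bounded on $A^q_\alpha$ if $\|W_{u,\varphi}f\|_{q,\alpha}\le C\|f\|_{q,\alpha}$ for all $f\in A^q_\alpha$ and some $C$. A weight is a nonnegative measurable function on $\mathbb{R}^2_+$ that is positive on a set of positive measure. Given $\alpha>-1$, $q>1$, $u\in H(\mathbb{R}^2_+)$ and $\varphi:\mathbb{R}^2_+\to\mathbb{R}^2_+$, the class $\mathbf{B}^{\alpha,q}_{u,\varphi}$ consists of all weights $\omega$ on $\mathbb{R}^2_+$ with $$[\omega]_{\mathbf{B}^{\alpha,q}_{u,\varphi}}:=\sup_{\zeta\in\mathbb{R}^2_+}\int_{\mathbb{R}^2_+}\frac{|u(z)|^q\omega(z)}{|\bar\zeta-\varphi(z)|^{\alpha+2}}\,dA_\alpha(z)<\infty.$$ For $a=x_a+iy_a\in\mathbb{R}^2_+$,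 the Carleson tent is $T_a=\{x+iy\in\mathbb{R}^2_+:|x-x_a|\le y_a/2,\ 0<y<y_a\}$. A measure $\mu$ on $\mathbb{R}^2_+$ is a $1$-Carleson measure if $\sup_{a\in\mathbb{R}^2_+}\mu(T_a)/A_\alpha(T_a)<\infty$. *)

theory Defs
  imports "HOL-Complex_Analysis.Complex_Analysis"
begin

definition upper_half_plane :: "complex set" where
  "upper_half_plane = {z. Im z > 0}"

definition bergman_measure :: "real \<Rightarrow> complex measure" where
  "bergman_measure \<alpha> =
     density (lebesgue_on upper_half_plane)
       (\<lambda>z. ennreal (1 / pi * (\<alpha> + 1) * (2 * Im z) powr \<alpha>))"

text \<open>The real power on [0, \<infinity>]; it is used for exponents \<open>p > 0\<close> only.\<close>

definition ennreal_powr :: "ennreal \<Rightarrow> real \<Rightarrow> ennreal" where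
  "ennreal_powr x p = (if x = \<infinity> then \<infinity> else ennreal (enn2real x powr p))"

definition bergman_norm :: "real \<Rightarrow> real \<Rightarrow> (complex \<Rightarrow> complex) \<Rightarrow> ennreal" where
  "bergman_norm p \<alpha> f =
     ennreal_powr (\<integral>\<^sup>+ z. ennreal (norm (f z) powr p) \<partial>bergman_measure \<alpha>) (1 / p)"

definition bergman_space :: "real \<Rightarrow> real \<Rightarrow> (complex \<Rightarrow> complex) set" where
  "bergman_space p \<alpha> =
     {f. f holomorphic_on upper_half_plane \<and> bergman_norm p \<alpha> f < \<infinity>}"

definition weighted_comp ::
  "(complex \<Rightarrow> complex) \<Rightarrow> (complex \<Rightarrow> complex) \<Rightarrow> (complex \<Rightarrow> complex) \<Rightarrow> complex \<Rightarrow> complex" where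
  "weighted_comp u \<phi> f = (\<lambda>z. u z * f (\<phi> z))"

definition bounded_on_bergman ::
  "real \<Rightarrow> real \<Rightarrow> ((complex \<Rightarrow> complex) \<Rightarrow> complex \<Rightarrow> complex) \<Rightarrow> bool" where
  "bounded_on_bergman q \<alpha> T \<longleftrightarrow>
     (\<exists>C::real. \<forall>f \<in> bergman_space q \<alpha>.
        bergman_norm q \<alpha> (T f) \<le> ennreal C * bergman_norm q \<alpha> f)"

text \<open>Functions are total here; a weight is constrained on the half-plane only.\<close>

definition is_weight :: "(complex \<Rightarrow> real) \<Rightarrow> bool" where
  "is_weight \<omega> \<longleftrightarrow>
     \<omega> \<in> borel_measurable (lebesgue_on upper_half_plane) \<and>
     (\<forall>z \<in> upper_half_plane. 0 \<le> \<omega> z) \<and>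
     emeasure lebesgue {z \<in> upper_half_plane. 0 < \<omega> z} > 0"

definition B_const ::
  "real \<Rightarrow> real \<Rightarrow> (complex \<Rightarrow> complex) \<Rightarrow> (complex \<Rightarrow> complex) \<Rightarrow> (complex \<Rightarrow> real) \<Rightarrow> ennreal" where
  "B_const \<alpha> q u \<phi> \<omega> =
     (SUP \<zeta> \<in> upper_half_plane.
        \<integral>\<^sup>+ z. ennreal (norm (u z) powr q * \<omega> z / norm (cnj \<zeta> - \<phi> z) powr (\<alpha> + 2))
          \<partial>bergman_measure \<alpha>)"

definition B_class ::
  "real \<Rightarrow> real \<Rightarrow> (complex \<Rightarrow> complex) \<Rightarrow> (complex \<Rightarrow> complex) \<Rightarrow> (complex \<Rightarrow> real) set" where
  "B_class \<alpha> q u \<phi> = {\<omega>. is_weight \<omega> \<and> B_const \<alpha> q u \<phi> \<omega> < \<infinity>}"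

definition carleson_tent :: "complex \<Rightarrow> complex set" where
  "carleson_tent a =
     {z \<in> upper_half_plane. \<bar>Re z - Re a\<bar> \<le> Im a / 2 \<and> 0 < Im z \<and> Im z < Im a}"

definition one_carleson :: "real \<Rightarrow> complex measure \<Rightarrow> bool" where
  "one_carleson \<alpha> \<mu> \<longleftrightarrow>
     sets \<mu> = sets (restrict_space borel upper_half_plane) \<and>
     (SUP a \<in> upper_half_plane.
        emeasure \<mu> (carleson_tent a) / emeasure (bergman_measure \<alpha>) (carleson_tent a)) < \<infinity>"

text \<open>
  The Borel measure determined by its integrals against measurable \<open>g\<close> is constructed as
  the image under \<open>\<phi>\<close> of the measure with density \<open>|u|^q \<omega>\<close>; the determining formula is
  proved in \<open>nn_integral_pullback_measure\<close> below.
\<close>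

definition pullback_measure ::
  "(complex \<Rightarrow> complex) \<Rightarrow> (complex \<Rightarrow> complex) \<Rightarrow> real \<Rightarrow> (complex \<Rightarrow> real) \<Rightarrow> real
     \<Rightarrow> complex measure" where
  "pullback_measure u \<phi> q \<omega> \<alpha> =
     distr (density (bergman_measure \<alpha>) (\<lambda>z. ennreal (norm (u z) powr q * \<omega> z)))
       (restrict_space borel upper_half_plane) \<phi>"

lemma upper_half_plane_borel: "upper_half_plane \<in> sets borel"
  unfolding upper_half_plane_def by (intro borel_open open_halfspace_Im_gt)

lemma sets_bergman_measure: "sets (bergman_measure \<alpha>) = sets (lebesgue_on upper_half_plane)"
  by (simp add: bergman_measure_def)

lemma holomorphic_measurable_bergman:
  assumes "f holomorphic_on upper_half_plane"
  shows "f \<in> borel_measurable (bergman_measure \<alpha>)"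
proof -
  have "f \<in> borel_measurable (lebesgue_on upper_half_plane)"
    by (intro continuous_imp_measurable_on_sets_lebesgue holomorphic_on_imp_continuous_on assms)
       (use upper_half_plane_borel in auto)
  then show ?thesis
    by (simp add: measurable_cong_sets[OF sets_bergman_measure refl])
qed

lemma nn_integral_pullback_measure:
  fixes g :: "complex \<Rightarrow> ennreal"
  assumes "u holomorphic_on upper_half_plane"
    and "\<phi> holomorphic_on upper_half_plane"
    and "\<phi> ` upper_half_plane \<subseteq> upper_half_plane"
    and "is_weight \<omega>"
    and g: "g \<in> borel_measurable (restrict_space borel upper_half_plane)"
  shows "(\<integral>\<^sup>+ w. g w \<partial>pullback_measure u \<phi> q \<omega> \<alpha>) =
    (\<integral>\<^sup>+ z. ennreal (norm (u z) powr q) * g (\<phi> z) * ennreal (\<omega> z) \<partial>bergman_measure \<alpha>)"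
proof -
  let ?A = "bergman_measure \<alpha>"
  have sp: "space ?A = upper_half_plane"
    by (simp add: bergman_measure_def)
  have u: "u \<in> borel_measurable ?A" and "\<phi> \<in> borel_measurable ?A"
    using assms by (auto intro: holomorphic_measurable_bergman)
  then have \<phi>: "\<phi> \<in> measurable ?A (restrict_space borel upper_half_plane)"
    using assms(3) by (intro measurable_restrict_space2) (auto simp: sp)
  have \<omega>: "\<omega> \<in> borel_measurable ?A"
    using assms(4) by (simp add: is_weight_def measurable_cong_sets[OF sets_bergman_measure refl])
  have d: "(\<lambda>z. ennreal (norm (u z) powr q * \<omega> z)) \<in> borel_measurable ?A"
    using u \<omega> by measurable
  have g\<phi>: "(\<lambda>z. g (\<phi> z)) \<in> borel_measurable ?A"
    using measurable_compose[OF \<phi> g] .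
  have "(\<integral>\<^sup>+ w. g w \<partial>pullback_measure u \<phi> q \<omega> \<alpha>) =
      (\<integral>\<^sup>+ z. ennreal (norm (u z) powr q * \<omega> z) * g (\<phi> z) \<partial>?A)"
    unfolding pullback_measure_def using \<phi> g d g\<phi>
    by (subst nn_integral_distr) (auto simp: nn_integral_density)
  also have "\<dots> = (\<integral>\<^sup>+ z. ennreal (norm (u z) powr q) * g (\<phi> z) * ennreal (\<omega> z) \<partial>?A)"
    by (intro nn_integral_cong)
       (use assms(4) in \<open>auto simp: sp is_weight_def ennreal_mult mult_ac\<close>)
  finally show ?thesis .
qed

end

theory Submission
  imports Defs
begin

text \<open>
  Write \<open>g = |u|^q |f \<circ> \<phi>|^q\<close>. The estimate for \<open>g * \<omega>\<close> follows from two others. Boundedness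
  of the weighted composition operator bounds the integral of \<open>g\<close> by a constant times the
  \<open>q\<close>-th power of the norm of \<open>f\<close>, and the condition on \<open>\<omega> powr s'\<close> bounds the integral of
  \<open>g * \<omega> powr s'\<close> by a constant times \<open>B_const\<close> and the same power of the norm. Interpolation
  between the exponents \<open>0\<close> and \<open>s'\<close> of \<open>\<omega>\<close> (\<open>nn_integral_weight_interpolation\<close>) gives the
  exponent \<open>1\<close>, and with it the power \<open>1 / s'\<close> of \<open>B_const\<close>.

  The second bound is the Carleson embedding \<open>nn_integral_comp_le_B_const\<close>, which is proved
  without passing through tents: by subharmonicity (\<open>disc_submean_powr\<close>) the value \<open>|f w|^q\<close> is
  at most the mean of \<open>|f|^q\<close> over the disc of radius \<open>Im w / 2\<close> around \<open>w\<close>; on this disc the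
  normalised area element is dominated, up to a constant, by the kernel
  \<open>|cnj \<zeta> - w| powr (- (\<alpha> + 2))\<close> times the Bergman measure (\<open>kernel_ge_on_disc\<close>);
  with \<open>w = \<phi> z\<close>, Tonelli turns the integral over \<open>z\<close> into the very integral whose supremum over \<open>\<zeta>\<close> is \<open>B_const\<close>.

  For the Carleson property, apply the estimate to \<open>f z = 1 / (z - cnj a) ^ k\<close>. On the tent at
  \<open>a\<close> its modulus is at least \<open>(3 * Im a) powr (- k)\<close>, and the \<open>q\<close>-th power of its norm scales like
  \<open>Im a powr (\<alpha> + 2 - k * q)\<close> (\<open>nn_integral_bergman_kernel\<close>), so the tent has measure at most a
  constant times \<open>Im a powr (\<alpha> + 2)\<close>, which is comparable to its Bergman measure
  (\<open>emeasure_carleson_tent\<close>).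
\<close>

section \<open>Lebesgue measure on the complex plane\<close>

lemma measurable_Complex [measurable (raw)]:
  assumes "f \<in> borel_measurable M" "g \<in> borel_measurable M"
  shows "(\<lambda>x. Complex (f x) (g x)) \<in> borel_measurable M"
  unfolding Complex_eq using assms by measurable

lemma lborel_complex_eq_distr:
  "(lborel :: complex measure) = distr (lborel \<Otimes>\<^sub>M lborel) borel (\<lambda>(x, y). Complex x y)"
proof (rule lborel_eqI)
  fix l u :: complex
  assume le: "\<And>b. b \<in> Basis \<Longrightarrow> l \<bullet> b \<le> u \<bullet> b"
  have "Re l \<le> Re u" "Im l \<le> Im u"
    using le[of 1] le[of \<i>] by (auto simp: Basis_complex_def inner_complex_def)
  moreover have "(\<lambda>(x, y). Complex x y) -` box l u = box (Re l) (Re u) \<times> box (Im l) (Im u)"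
    by (auto simp: box_def Basis_complex_def inner_complex_def)
  ultimately show "emeasure (distr (lborel \<Otimes>\<^sub>M lborel) borel (\<lambda>(x, y). Complex x y)) (box l u)
      = ennreal (\<Prod>b\<in>Basis. (u - l) \<bullet> b)"
    by (subst emeasure_distr)
       (auto simp: space_pair_measure lborel.emeasure_pair_measure_Times Basis_complex_def
          inner_complex_def ennreal_mult)
qed simp

lemma nn_integral_lborel_complex:
  fixes h :: "complex \<Rightarrow> ennreal"
  assumes [measurable]: "h \<in> borel_measurable borel"
  shows "(\<integral>\<^sup>+ z. h z \<partial>lborel) = (\<integral>\<^sup>+ x. \<integral>\<^sup>+ y. h (Complex x y) \<partial>lborel \<partial>lborel)"
  by (subst lborel_complex_eq_distr)
     (simp add: nn_integral_distr lborel.nn_integral_fst[symmetric])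

lemma nn_integral_lborel_complex':
  fixes h :: "complex \<Rightarrow> ennreal"
  assumes [measurable]: "h \<in> borel_measurable borel"
  shows "(\<integral>\<^sup>+ z. h z \<partial>lborel) = (\<integral>\<^sup>+ y. \<integral>\<^sup>+ x. h (Complex x y) \<partial>lborel \<partial>lborel)"
  unfolding nn_integral_lborel_complex[OF assms]
  by (rule lborel_pair.Fubini') simp

text \<open>
  A rotation is a product of two shears and a scaling of the coordinates, so Tonelli and
  one-dimensional affine substitutions suffice. The first substitution divides by the real part of
  \<open>c\<close>.
\<close>

lemma nn_integral_rotate_Re_nonzero:
  fixes h :: "complex \<Rightarrow> ennreal"
  assumes [measurable]: "h \<in> borel_measurable borel" and c: "norm c = 1" "Re c \<noteq> 0"
  shows "(\<integral>\<^sup>+ z. h (c * z) \<partial>lborel) = (\<integral>\<^sup>+ z. h z \<partial>lborel)"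
proof -
  define a b where "a = Re c" and "b = Im c"
  have a: "a \<noteq> 0" and ab: "a * a + b * b = 1"
    using c by (auto simp: a_def b_def norm_complex_def power2_eq_square)
  have c_mult: "c * Complex x y = Complex (a * x - b * y) (b * x + a * y)" for x y
    by (simp add: complex_eq_iff a_def b_def)
  have x_eq: "a * (b * y / a + 1 / a * x) - b * y = x" for x y
    using a by (simp add: field_simps)
  have y_eq: "b * (b * y / a + 1 / a * x) + a * y = (b / a) * x + y / a" for x y
  proof -
    have "b * (b * y / a + 1 / a * x) + a * y = (b / a) * x + (a * a + b * b) * y / a"
      using a by (simp add: field_simps)
    then show ?thesis by (simp add: ab)
  qed
  have "(\<integral>\<^sup>+ z. h (c * z) \<partial>lborel)
      = (\<integral>\<^sup>+ y. \<integral>\<^sup>+ x. h (Complex (a * x - b * y) (b * x + a * y)) \<partial>lborel \<partial>lborel)"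
    by (subst nn_integral_lborel_complex') (simp_all add: c_mult)
  also have "\<dots> = (\<integral>\<^sup>+ y. \<bar>1 / a\<bar> * (\<integral>\<^sup>+ x. h (Complex x ((b / a) * x + y / a)) \<partial>lborel) \<partial>lborel)"
  proof (rule nn_integral_cong)
    fix y
    show "(\<integral>\<^sup>+ x. h (Complex (a * x - b * y) (b * x + a * y)) \<partial>lborel)
        = \<bar>1 / a\<bar> * (\<integral>\<^sup>+ x. h (Complex x ((b / a) * x + y / a)) \<partial>lborel)"
      using a
      by (subst nn_integral_real_affine[where c = "1 / a" and t = "b * y / a"])
         (simp_all only: x_eq y_eq, simp_all)
  qed
  also have "\<dots> = \<bar>1 / a\<bar> * (\<integral>\<^sup>+ x. \<integral>\<^sup>+ y. h (Complex x ((b / a) * x + y / a)) \<partial>lborel \<partial>lborel)"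
    by (subst nn_integral_cmult, measurable, subst lborel_pair.Fubini') simp_all
  also have "(\<integral>\<^sup>+ x. \<integral>\<^sup>+ y. h (Complex x ((b / a) * x + y / a)) \<partial>lborel \<partial>lborel)
      = (\<integral>\<^sup>+ x. \<bar>a\<bar> * (\<integral>\<^sup>+ y. h (Complex x y) \<partial>lborel) \<partial>lborel)"
  proof (rule nn_integral_cong)
    fix x
    show "(\<integral>\<^sup>+ y. h (Complex x ((b / a) * x + y / a)) \<partial>lborel)
        = \<bar>a\<bar> * (\<integral>\<^sup>+ y. h (Complex x y) \<partial>lborel)"
      using a
      by (subst nn_integral_real_affine[where c = a and t = "- (b * x)"])
         (simp_all add: add_divide_distrib[symmetric] diff_divide_distrib)
  qed
  also have "\<bar>1 / a\<bar> * \<dots> = (\<integral>\<^sup>+ x. \<integral>\<^sup>+ y. h (Complex x y) \<partial>lborel \<partial>lborel)"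
    using a
    by (subst nn_integral_cmult, measurable)
       (simp add: mult.assoc[symmetric] ennreal_mult[symmetric])
  finally show ?thesis
    by (simp add: nn_integral_lborel_complex)
qed

lemma nn_integral_rotate:
  fixes h :: "complex \<Rightarrow> ennreal"
  assumes [measurable]: "h \<in> borel_measurable borel" and c: "norm c = 1"
  shows "(\<integral>\<^sup>+ z. h (c * z) \<partial>lborel) = (\<integral>\<^sup>+ z. h z \<partial>lborel)"
proof (cases "Re c = 0")
  case False
  then show ?thesis using assms nn_integral_rotate_Re_nonzero by blast
next
  case True
  \<comment> \<open>A quarter turn is the square of an eighth turn, whose real part does not vanish.\<close>
  define d where "d = csqrt c"
  have d: "d * d = c"
    by (simp add: d_def power2_eq_square[symmetric])
  then have "norm d * norm d = 1"
    using c by (metis norm_mult)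
  then have nd: "norm d = 1"
    using abs_square_eq_1[of "norm d"] by (simp add: power2_eq_square)
  have "Re d \<noteq> 0"
  proof
    assume "Re d = 0"
    then have "c = - of_real (Im d * Im d)"
      using d by (auto simp: complex_eq_iff)
    with True c show False by (auto simp: complex_eq_iff norm_complex_def)
  qed
  then show ?thesis
    using nn_integral_rotate_Re_nonzero[of "\<lambda>z. h (d * z)" d] nn_integral_rotate_Re_nonzero[of h d]
    by (simp add: nd d mult.assoc[symmetric])
qed

lemma nn_integral_lborel_affine:
  fixes h :: "complex \<Rightarrow> ennreal"
  assumes [measurable]: "h \<in> borel_measurable borel" and "0 < c"
  shows "(\<integral>\<^sup>+ z. h z \<partial>lborel) = ennreal (c ^ 2) * (\<integral>\<^sup>+ z. h (t + c *\<^sub>R z) \<partial>lborel)"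
  using assms(2)
  by (subst lborel_affine[of c t])
     (simp_all add: nn_integral_density nn_integral_distr nn_integral_cmult ennreal_power)

section \<open>Subharmonicity of powers of the modulus\<close>

text \<open>
  The mean value property along the orbit of \<open>z\<close> under rotation, rather than along a circle of
  given radius: this form can be integrated in \<open>z\<close> without polar coordinates. It is Cauchy's
  formula on the unit circle for \<open>v \<mapsto> f (w + v * z)\<close>.
\<close>

lemma circle_mean:
  assumes "f holomorphic_on cball w (norm z)" "z \<noteq> 0"
  shows "((\<lambda>t. f (w + exp (2 * pi * \<i> * of_real t) * z)) has_integral f w) {0..1::real}"
proof -
  define g where "g = (\<lambda>v. f (w + v * z))"
  have "g holomorphic_on cball 0 1"
    unfolding g_def
    by (rule holomorphic_on_compose_gen[of "\<lambda>v. w + v * z" _ f, unfolded o_def, OF _ assms(1)])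
       (auto intro!: holomorphic_intros simp: dist_norm norm_mult mult_left_le_one_le)
  then have "((\<lambda>v. g v / (v - 0)) has_contour_integral (2 * of_real pi * \<i> * g 0)) (circlepath 0 1)"
    by (intro Cauchy_integral_circlepath holomorphic_on_imp_continuous_on)
       (auto intro: holomorphic_on_subset)
  then have "((\<lambda>t. g (exp (2 * pi * \<i> * of_real t)) * (2 * of_real pi * \<i>))
      has_integral (2 * of_real pi * \<i> * g 0)) {0..1}"
    unfolding has_contour_integral_def
  proof (rule has_integral_eq[rotated])
    fix t :: real
    assume "t \<in> {0..1}"
    then have "vector_derivative (circlepath 0 1) (at t within {0..1})
        = 2 * pi * \<i> * exp (2 * pi * \<i> * t)"
      by (subst vector_derivative_circlepath01) simp_all
    then show "g (circlepath 0 1 t) / (circlepath 0 1 t - 0)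
          * vector_derivative (circlepath 0 1) (at t within {0..1})
        = g (exp (2 * pi * \<i> * of_real t)) * (2 * of_real pi * \<i>)"
      by (simp add: circlepath)
  qed
  from has_integral_divide[OF this, of "2 * of_real pi * \<i>"]
  show ?thesis by (simp add: g_def)
qed

lemma powr_above_tangent:
  fixes q c x :: real
  assumes "1 \<le> q" "0 < c" "0 \<le> x"
  shows "c powr q + q * c powr (q - 1) * (x - c) \<le> x powr q"
proof (cases "x = 0")
  case True
  have "c powr q + q * c powr (q - 1) * (x - c) = c powr q - q * c powr q"
    using assms True by (simp add: powr_diff)
  moreover have "c powr q \<le> q * c powr q"
    using assms mult_right_mono[of 1 q "c powr q"] by simp
  moreover have "0 \<le> x powr q" by simp
  ultimately show ?thesis by linarith
next
  case False
  have "(x powr q) - (c powr q) \<ge> (q * c powr (q - 1)) * (x - c)"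
    using assms False
    by (intro convex_on_imp_above_tangent[of "{0<..}"] powr_convex)
       (auto intro!: derivative_eq_intros simp: interior_open)
  then show ?thesis by simp
qed

text \<open>
  Jensen's inequality for \<open>x \<mapsto> x powr q\<close>: integrate over the circle the tangent line of this
  function at the value \<open>norm (f w)\<close>. The slope is nonnegative and the mean of \<open>norm \<circ> f\<close> is at
  least \<open>norm (f w)\<close>, so the linear term only helps.
\<close>

lemma circle_submean_powr:
  assumes f: "f holomorphic_on cball w (norm z)" and q: "1 \<le> q"
  shows "ennreal (norm (f w) powr q)
    \<le> (\<integral>\<^sup>+ t. indicator {0..1::real} t * ennreal (norm (f (w + exp (2 * pi * \<i> * of_real t) * z)) powr q) \<partial>lborel)"
proof (cases "z = 0 \<or> f w = 0")
  case True
  then show ?thesis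
    by (auto simp: nn_integral_multc)
next
  case False
  define c where "c = norm (f w)"
  define F where "F = (\<lambda>t. f (w + exp (2 * pi * \<i> * of_real t) * z))"
  have c: "0 < c" using False by (simp add: c_def)
  have F: "(F has_integral f w) {0..1}"
    unfolding F_def using circle_mean[OF f] False by blast
  have "continuous_on (cball w (norm z)) f"
    using f holomorphic_on_imp_continuous_on by blast
  then have cont: "continuous_on {0..1} F"
    unfolding F_def
    by (rule continuous_on_compose2) (auto intro!: continuous_intros simp: dist_norm norm_mult)
  have int: "(\<lambda>t. norm (F t)) integrable_on {0..1}" "(\<lambda>t. norm (F t) powr q) integrable_on {0..1}"
    using q by (intro integrable_continuous_interval continuous_on_powr' continuous_intros cont; simp)+
  have "c \<le> integral {0..1} (\<lambda>t. norm (F t))"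
    using integral_norm_bound_integral[of F "{0..1}" "\<lambda>t. norm (F t)"] F int
    by (auto simp: c_def has_integral_iff)
  then have "0 \<le> q * c powr (q - 1) * (integral {0..1} (\<lambda>t. norm (F t)) - c)"
    using q by simp
  also have "\<dots> = integral {0..1} (\<lambda>t. q * c powr (q - 1) * (norm (F t) - c))"
    using integral_diff[OF int(1) integrable_const_ivl, of c] by simp
  also have "\<dots> \<le> integral {0..1} (\<lambda>t. norm (F t) powr q - c powr q)"
  proof (rule integral_le)
    show "q * c powr (q - 1) * (norm (F t) - c) \<le> norm (F t) powr q - c powr q" for t
      using powr_above_tangent[OF q c, of "norm (F t)"] by simp
  qed (use int in \<open>auto intro!: integrable_on_mult_right integrable_diff\<close>)
  also have "\<dots> = integral {0..1} (\<lambda>t. norm (F t) powr q) - c powr q"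
    using integral_diff[OF int(2) integrable_const_ivl, of "c powr q"] by simp
  finally have "c powr q \<le> integral {0..1} (\<lambda>t. norm (F t) powr q)"
    by simp
  moreover have "(\<integral>\<^sup>+ t. ennreal (indicator {0..1} t * (norm (F t) powr q)) \<partial>lborel)
      = ennreal (integral {0..1} (\<lambda>t. norm (F t) powr q))"
    using int by (intro nn_integral_has_integral_lebesgue) (auto simp: has_integral_iff)
  ultimately show ?thesis
    unfolding c_def F_def by (simp add: ennreal_mult' ennreal_indicator ennreal_leI)
qed

text \<open>
  A function holomorphic on \<open>S\<close> has arbitrary values elsewhere; the indicator cuts them off.
\<close>

lemma borel_measurable_holomorphic_powr:
  assumes f: "f holomorphic_on S" and S: "open S"
  shows "(\<lambda>z. indicator S z * ennreal (norm (f z) powr q)) \<in> borel_measurable borel"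
proof -
  define g where "g = (\<lambda>z. indicator S z *\<^sub>R f z)"
  have [measurable]: "S \<in> sets borel"
    using S by simp
  have [measurable]: "g \<in> borel_measurable borel"
    unfolding g_def using assms
    by (intro borel_measurable_continuous_on_indicator holomorphic_on_imp_continuous_on) auto
  have "(\<lambda>z. indicator S z * ennreal (norm (g z) powr q)) \<in> borel_measurable borel"
    by measurable
  also have "(\<lambda>z. indicator S z * ennreal (norm (g z) powr q)) = (\<lambda>z. indicator S z * ennreal (norm (f z) powr q))"
    by (auto simp: g_def indicator_def)
  finally show ?thesis .
qed

text \<open>
  Integrate the circle inequality over all \<open>z\<close> in the disc around \<open>0\<close> and exchange the two
  integrals. By rotation invariance the integral over \<open>z\<close> does not depend on the angle.
\<close>

lemma disc_submean_powr:
  assumes f: "f holomorphic_on ball w r" and q: "1 \<le> q" and r: "0 < r"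
  shows "ennreal (pi * r\<^sup>2 * norm (f w) powr q)
    \<le> (\<integral>\<^sup>+ z. indicator (ball w r) z * ennreal (norm (f z) powr q) \<partial>lborel)"
proof -
  define h where "h = (\<lambda>z. indicator (ball w r) z * ennreal (norm (f z) powr q))"
  have h [measurable]: "h \<in> borel_measurable borel"
    unfolding h_def using f by (rule borel_measurable_holomorphic_powr) simp
  define e where "e = (\<lambda>t. exp (2 * pi * \<i> * complex_of_real t))"
  have [measurable]: "e \<in> borel_measurable borel"
    unfolding e_def by measurable
  have e: "norm (e t) = 1" for t
    by (simp add: e_def)
  have [measurable]: "ball 0 r \<in> sets (borel :: complex measure)"
    by simp
  have "ennreal (pi * r\<^sup>2 * norm (f w) powr q)
      = (\<integral>\<^sup>+ z. indicator (ball 0 r :: complex set) z * ennreal (norm (f w) powr q) \<partial>lborel)"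
    using r by (simp add: nn_integral_multc emeasure_ball unit_ball_vol_2 ennreal_mult')
  also have "\<dots> \<le> (\<integral>\<^sup>+ z. \<integral>\<^sup>+ t. indicator {0..1} t * h (w + e t * z) \<partial>lborel \<partial>lborel)"
  proof (rule nn_integral_mono)
    fix z :: complex
    show "indicator (ball 0 r) z * ennreal (norm (f w) powr q)
        \<le> (\<integral>\<^sup>+ t. indicator {0..1} t * h (w + e t * z) \<partial>lborel)"
    proof (cases "z \<in> ball 0 r")
      case True
      then have sub: "cball w (norm z) \<subseteq> ball w r" by auto
      have "h (w + e t * z) = ennreal (norm (f (w + e t * z)) powr q)" for t
        using True by (simp add: h_def dist_norm norm_mult e)
      then show ?thesis
        using circle_submean_powr[OF holomorphic_on_subset[OF f sub] q] True
        by (simp add: e_def)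
    qed simp
  qed
  also have "\<dots> = (\<integral>\<^sup>+ t. \<integral>\<^sup>+ z. indicator {0..1} t * h (w + e t * z) \<partial>lborel \<partial>lborel)"
    by (rule lborel_pair.Fubini') measurable
  also have "\<dots> = (\<integral>\<^sup>+ t. indicator {0..1::real} t * (\<integral>\<^sup>+ z. h z \<partial>lborel) \<partial>lborel)"
  proof (rule nn_integral_cong)
    fix t :: real
    have "(\<integral>\<^sup>+ z. h (w + e t * z) \<partial>lborel) = (\<integral>\<^sup>+ z. h (w + z) \<partial>lborel)"
      by (rule nn_integral_rotate) (simp_all add: e)
    also have "\<dots> = (\<integral>\<^sup>+ z. h z \<partial>lborel)"
      using nn_integral_lborel_affine[of h 1 w] by simp
    finally show "(\<integral>\<^sup>+ z. indicator {0..1} t * h (w + e t * z) \<partial>lborel)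
        = indicator {0..1} t * (\<integral>\<^sup>+ z. h z \<partial>lborel)"
      by (simp add: nn_integral_cmult)
  qed
  also have "\<dots> = (\<integral>\<^sup>+ z. h z \<partial>lborel)"
    by (simp add: nn_integral_multc)
  finally show ?thesis by (simp add: h_def)
qed

section \<open>The Bergman measure\<close>

lemma open_upper_half_plane: "open upper_half_plane"
  unfolding upper_half_plane_def by (rule open_halfspace_Im_gt)

lemma space_bergman_measure [simp]: "space (bergman_measure \<alpha>) = upper_half_plane"
  by (simp add: bergman_measure_def)

lemma measurable_bergman_measure_cong:
  "measurable (bergman_measure \<alpha>) N = measurable (lebesgue_on upper_half_plane) N"
  by (rule measurable_cong_sets[OF sets_bergman_measure refl])

text \<open>
  The density is taken with respect to Lebesgue--Borel measure on the whole plane because Tonelli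
  and the affine substitutions above are statements about \<open>lborel\<close>.
\<close>

definition bergman_density :: "real \<Rightarrow> complex \<Rightarrow> ennreal" where
  "bergman_density \<alpha> z =
     indicator upper_half_plane z * ennreal (1 / pi * (\<alpha> + 1) * (2 * Im z) powr \<alpha>)"

declare upper_half_plane_borel [measurable]

lemma borel_measurable_bergman_density [measurable]:
  "bergman_density \<alpha> \<in> borel_measurable borel"
  unfolding bergman_density_def by measurable

lemma borel_measurable_bergman_weight:
  "(\<lambda>z. ennreal (1 / pi * (\<alpha> + 1) * (2 * Im z) powr \<alpha>)) \<in> borel_measurable (lebesgue_on upper_half_plane)"
  by (intro measurable_restrict_space1 measurable_completion) measurable

lemma nn_integral_bergman_measure:
  fixes h :: "complex \<Rightarrow> ennreal"
  assumes h: "(\<lambda>z. indicator upper_half_plane z * h z) \<in> borel_measurable borel"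
  shows "(\<integral>\<^sup>+ z. h z \<partial>bergman_measure \<alpha>) = (\<integral>\<^sup>+ z. bergman_density \<alpha> z * h z \<partial>lborel)"
proof -
  have UHP: "upper_half_plane \<inter> space lebesgue \<in> sets lebesgue"
    using upper_half_plane_borel by auto
  have "(\<lambda>z. h z * indicator upper_half_plane z) \<in> borel_measurable lebesgue"
    using h by (intro measurable_completion) (simp add: mult.commute)
  then have h': "h \<in> borel_measurable (lebesgue_on upper_half_plane)"
    using UHP by (subst borel_measurable_restrict_space_iff_ennreal) auto
  show ?thesis
    unfolding bergman_measure_def
    by (subst nn_integral_density[OF borel_measurable_bergman_weight h'],
        subst nn_integral_restrict_space[OF UHP], subst nn_integral_completion)
       (simp add: bergman_density_def mult_ac)
qed

lemma borel_measurable_bergman_comp: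
  assumes "f holomorphic_on upper_half_plane" "\<phi> holomorphic_on upper_half_plane"
    and "\<phi> ` upper_half_plane \<subseteq> upper_half_plane"
  shows "(\<lambda>z. f (\<phi> z)) \<in> borel_measurable (bergman_measure \<alpha>)"
proof -
  have "(f \<circ> \<phi>) holomorphic_on upper_half_plane"
    using assms by (intro holomorphic_on_compose_gen)
  then show ?thesis
    using holomorphic_measurable_bergman by (auto simp: o_def)
qed

lemma sigma_finite_completion:
  assumes "sigma_finite_measure M"
  shows "sigma_finite_measure (completion M)"
proof
  interpret sigma_finite_measure M by fact
  obtain A where "countable A" "A \<subseteq> sets M" "\<Union>A = space M" "\<forall>a\<in>A. emeasure M a \<noteq> \<infinity>"
    using sigma_finite_countable by blast
  then show "\<exists>A. countable A \<and> A \<subseteq> sets (completion M) \<and> \<Union>A = space (completion M)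
      \<and> (\<forall>a\<in>A. emeasure (completion M) a \<noteq> \<infinity>)"
    by (intro exI[of _ A]) auto
qed

lemma sigma_finite_bergman_measure: "sigma_finite_measure (bergman_measure \<alpha>)"
proof -
  have "sigma_finite_measure (lebesgue_on upper_half_plane)"
    using upper_half_plane_borel
    by (intro sigma_finite_measure_restrict_space sigma_finite_completion sigma_finite_lborel) auto
  then show ?thesis
    unfolding bergman_measure_def
    by (subst sigma_finite_measure.sigma_finite_iff_density_finite[OF _ borel_measurable_bergman_weight]) auto
qed

section \<open>The embedding theorem\<close>

text \<open>
  On the disc of radius \<open>Im w / 2\<close> around \<open>w\<close> the three quantities \<open>Im w\<close>, \<open>Im z\<close> and
  \<open>norm (cnj z - w)\<close> are comparable, namely \<open>Im z \<le> 3/2 * Im w\<close> and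
  \<open>norm (cnj z - w) \<le> 3 * Im z\<close>. The left side is the reciprocal of the area of the disc, so the
  lemma replaces averaging over the disc by the kernel that defines \<open>B_const\<close>.
\<close>

lemma kernel_ge_on_disc:
  assumes w: "0 < Im w" and z: "z \<in> ball w (Im w / 2)" and \<alpha>: "-1 < \<alpha>"
  shows "4 / (pi * (Im w)\<^sup>2)
    \<le> 9 * 3 powr (\<alpha> + 2) / pi * Im z powr \<alpha> / norm (cnj z - w) powr (\<alpha> + 2)"
proof -
  have zw: "norm (w - z) < Im w / 2"
    using z by (simp add: dist_norm)
  have "\<bar>Im w - Im z\<bar> < Im w / 2"
    using abs_Im_le_cmod[of "w - z"] zw by simp
  then have Im: "Im w / 2 < Im z" "Im z < 3 / 2 * Im w"
    by linarith+
  then have Iz: "0 < Im z" using w by simp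
  have "norm (cnj z - w) \<le> norm (cnj z - z) + norm (z - w)"
    using norm_triangle_ineq[of "cnj z - z" "z - w"] by simp
  also have "cnj z - z = - (2 * of_real (Im z) * \<i>)"
    by (simp add: complex_eq_iff)
  then have "norm (cnj z - z) = 2 * Im z"
    using Iz by (simp add: norm_mult)
  also have "norm (z - w) \<le> Im z"
    using zw Im by (simp add: norm_minus_commute)
  finally have "norm (cnj z - w) \<le> 3 * Im z"
    by simp
  then have le: "norm (cnj z - w) powr (\<alpha> + 2) \<le> (3 * Im z) powr (\<alpha> + 2)"
    using \<alpha> by (intro powr_mono2) auto
  have "Im (cnj z - w) \<noteq> 0"
    using Iz w by simp
  then have "cnj z - w \<noteq> 0" by force
  then have pos: "0 < norm (cnj z - w) powr (\<alpha> + 2)"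
    by simp
  have "4 / (pi * (Im w)\<^sup>2) \<le> 9 / (pi * (Im z)\<^sup>2)"
  proof -
    have "(Im z)\<^sup>2 \<le> (3 / 2 * Im w)\<^sup>2"
      using Im Iz by (intro power_mono) auto
    then show ?thesis
      using w Iz by (simp add: field_simps power2_eq_square)
  qed
  also have "\<dots> = 9 / pi * Im z powr \<alpha> * (3 powr (\<alpha> + 2) / (3 * Im z) powr (\<alpha> + 2))"
    using Iz by (simp add: powr_mult powr_add power2_eq_square divide_simps)
  also have "\<dots> \<le> 9 / pi * Im z powr \<alpha> * (3 powr (\<alpha> + 2) / norm (cnj z - w) powr (\<alpha> + 2))"
    using le pos by (intro mult_left_mono divide_left_mono) (use Iz in auto)
  finally show ?thesis by (simp add: mult_ac)
qed

text \<open>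
  The embedding theorem behind the whole argument. Each value \<open>norm (f (\<phi> z)) powr q\<close> is at most
  the average of \<open>norm (f \<zeta>) powr q\<close> over a disc around \<open>\<phi> z\<close>, hence at most a constant times the
  integral of \<open>norm (f \<zeta>) powr q\<close> against the kernel \<open>norm (cnj \<zeta> - \<phi> z) powr (- (\<alpha> + 2))\<close>
  and the measure \<open>bergman_measure \<alpha>\<close>. Tonelli moves the \<open>z\<close>-integral inside, and there the
  kernel, weighted by \<open>norm (u z) powr q * \<omega> z\<close>, integrates to at most \<open>B_const\<close>.
\<close>

lemma nn_integral_comp_le_B_const:
  assumes u: "u holomorphic_on upper_half_plane"
    and \<phi>: "\<phi> holomorphic_on upper_half_plane" "\<phi> ` upper_half_plane \<subseteq> upper_half_plane"
    and \<omega>: "\<omega> \<in> borel_measurable (lebesgue_on upper_half_plane)"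
    and \<omega>_nonneg: "\<And>z. z \<in> upper_half_plane \<Longrightarrow> 0 \<le> \<omega> z"
    and f: "f holomorphic_on upper_half_plane"
    and q: "1 \<le> q" and \<alpha>: "-1 < \<alpha>"
  shows "(\<integral>\<^sup>+ z. ennreal (norm (u z) powr q * norm (f (\<phi> z)) powr q * \<omega> z) \<partial>bergman_measure \<alpha>)
    \<le> ennreal (9 * 3 powr (\<alpha> + 2) / ((\<alpha> + 1) * 2 powr \<alpha>)) * B_const \<alpha> q u \<phi> \<omega>
        * (\<integral>\<^sup>+ z. ennreal (norm (f z) powr q) \<partial>bergman_measure \<alpha>)"
proof -
  let ?M = "bergman_measure \<alpha>"
  interpret M: sigma_finite_measure ?M
    by (rule sigma_finite_bergman_measure)
  interpret P: pair_sigma_finite ?M "lborel :: complex measure" ..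
  have [measurable]: "u \<in> borel_measurable ?M" "\<phi> \<in> borel_measurable ?M"
    using u \<phi> by (auto intro: holomorphic_measurable_bergman)
  have [measurable]: "\<omega> \<in> borel_measurable ?M"
    using \<omega> by (simp add: measurable_bergman_measure_cong)
  have [measurable]: "cnj \<in> borel_measurable borel"
    by (intro borel_measurable_continuous_onI continuous_intros)
  define F where "F = (\<lambda>\<zeta>. indicator upper_half_plane \<zeta> * ennreal (norm (f \<zeta>) powr q))"
  have F [measurable]: "F \<in> borel_measurable borel"
    unfolding F_def by (rule borel_measurable_holomorphic_powr[OF f open_upper_half_plane])
  define c where "c = 9 * 3 powr (\<alpha> + 2) / pi"
  have c: "0 \<le> c" by (simp add: c_def)
  define K where "K = (\<lambda>z \<zeta>. ennreal (norm (u z) powr q * \<omega> z / norm (cnj \<zeta> - \<phi> z) powr (\<alpha> + 2)))"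
  have [measurable]: "(\<lambda>(z, \<zeta>). K z \<zeta>) \<in> borel_measurable (?M \<Otimes>\<^sub>M lborel)"
    unfolding K_def by measurable
  have "(\<integral>\<^sup>+ z. ennreal (norm (u z) powr q * norm (f (\<phi> z)) powr q * \<omega> z) \<partial>?M)
      \<le> (\<integral>\<^sup>+ z. \<integral>\<^sup>+ \<zeta>. K z \<zeta> * (ennreal (c * Im \<zeta> powr \<alpha>) * F \<zeta>) \<partial>lborel \<partial>?M)"
  proof (rule nn_integral_mono)
    fix z assume "z \<in> space ?M"
    then have z: "z \<in> upper_half_plane" by simp
    define w where "w = \<phi> z"
    define r where "r = Im w / 2"
    have w: "0 < Im w"
      using \<phi>(2) z by (auto simp: w_def upper_half_plane_def)
    then have r: "0 < r" by (simp add: r_def)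
    have sub: "ball w r \<subseteq> upper_half_plane"
    proof
      fix \<zeta> assume "\<zeta> \<in> ball w r"
      then have "\<bar>Im w - Im \<zeta>\<bar> < Im w / 2"
        using abs_Im_le_cmod[of "w - \<zeta>"] by (simp add: dist_norm r_def)
      then have "0 < Im \<zeta>"
        using w by linarith
      then show "\<zeta> \<in> upper_half_plane"
        by (simp add: upper_half_plane_def)
    qed
    define g where "g = norm (u z) powr q * \<omega> z"
    have g: "0 \<le> g" using \<omega>_nonneg[OF z] by (simp add: g_def)
    have "ennreal (norm (u z) powr q * norm (f (\<phi> z)) powr q * \<omega> z)
        = ennreal (g * (4 / (pi * (Im w)\<^sup>2))) * ennreal (pi * r\<^sup>2 * norm (f w) powr q)"
      using w g
      by (subst ennreal_mult[symmetric]) (auto simp: g_def w_def r_def power2_eq_square field_simps)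
    also have "\<dots> \<le> ennreal (g * (4 / (pi * (Im w)\<^sup>2)))
        * (\<integral>\<^sup>+ \<zeta>. indicator (ball w r) \<zeta> * ennreal (norm (f \<zeta>) powr q) \<partial>lborel)"
      by (intro mult_left_mono disc_submean_powr holomorphic_on_subset[OF f sub] q r) simp
    also have "\<dots> = (\<integral>\<^sup>+ \<zeta>. ennreal (g * (4 / (pi * (Im w)\<^sup>2)))
        * (indicator (ball w r) \<zeta> * ennreal (norm (f \<zeta>) powr q)) \<partial>lborel)"
      using borel_measurable_holomorphic_powr[OF holomorphic_on_subset[OF f sub]]
      by (subst nn_integral_cmult) auto
    also have "\<dots> \<le> (\<integral>\<^sup>+ \<zeta>. K z \<zeta> * (ennreal (c * Im \<zeta> powr \<alpha>) * F \<zeta>) \<partial>lborel)"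
    proof (rule nn_integral_mono)
      fix \<zeta>
      show "ennreal (g * (4 / (pi * (Im w)\<^sup>2))) * (indicator (ball w r) \<zeta> * ennreal (norm (f \<zeta>) powr q))
          \<le> K z \<zeta> * (ennreal (c * Im \<zeta> powr \<alpha>) * F \<zeta>)"
      proof (cases "\<zeta> \<in> ball w r")
        case True
        have "g * (4 / (pi * (Im w)\<^sup>2))
            \<le> g * (9 * 3 powr (\<alpha> + 2) / pi * Im \<zeta> powr \<alpha> / norm (cnj \<zeta> - w) powr (\<alpha> + 2))"
          using kernel_ge_on_disc[OF w _ \<alpha>] True g by (intro mult_left_mono) (auto simp: r_def)
        also have "\<dots> = (g / norm (cnj \<zeta> - w) powr (\<alpha> + 2)) * (c * Im \<zeta> powr \<alpha>)"
          by (simp add: c_def)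
        finally have "ennreal (g * (4 / (pi * (Im w)\<^sup>2)))
            \<le> ennreal (g / norm (cnj \<zeta> - w) powr (\<alpha> + 2)) * ennreal (c * Im \<zeta> powr \<alpha>)"
          using g c by (subst ennreal_mult[symmetric]) (auto intro!: ennreal_leI)
        then have "ennreal (g * (4 / (pi * (Im w)\<^sup>2))) * F \<zeta>
            \<le> K z \<zeta> * ennreal (c * Im \<zeta> powr \<alpha>) * F \<zeta>"
          by (intro mult_right_mono) (auto simp: K_def g_def w_def)
        then show ?thesis
          using True sub by (auto simp: F_def mult.assoc)
      qed simp
    qed
    finally show "ennreal (norm (u z) powr q * norm (f (\<phi> z)) powr q * \<omega> z)
        \<le> (\<integral>\<^sup>+ \<zeta>. K z \<zeta> * (ennreal (c * Im \<zeta> powr \<alpha>) * F \<zeta>) \<partial>lborel)" .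
  qed
  also have "\<dots> = (\<integral>\<^sup>+ \<zeta>. \<integral>\<^sup>+ z. K z \<zeta> * (ennreal (c * Im \<zeta> powr \<alpha>) * F \<zeta>) \<partial>?M \<partial>lborel)"
    by (rule P.Fubini'[symmetric]) measurable
  also have "\<dots> \<le> (\<integral>\<^sup>+ \<zeta>. B_const \<alpha> q u \<phi> \<omega> * (ennreal (c * Im \<zeta> powr \<alpha>) * F \<zeta>) \<partial>lborel)"
  proof (rule nn_integral_mono)
    fix \<zeta> :: complex
    show "(\<integral>\<^sup>+ z. K z \<zeta> * (ennreal (c * Im \<zeta> powr \<alpha>) * F \<zeta>) \<partial>?M)
        \<le> B_const \<alpha> q u \<phi> \<omega> * (ennreal (c * Im \<zeta> powr \<alpha>) * F \<zeta>)"
    proof (cases "\<zeta> \<in> upper_half_plane")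
      case True
      have "(\<integral>\<^sup>+ z. K z \<zeta> * (ennreal (c * Im \<zeta> powr \<alpha>) * F \<zeta>) \<partial>?M)
          = (\<integral>\<^sup>+ z. K z \<zeta> \<partial>?M) * (ennreal (c * Im \<zeta> powr \<alpha>) * F \<zeta>)"
        unfolding K_def by (rule nn_integral_multc) measurable
      also have "(\<integral>\<^sup>+ z. K z \<zeta> \<partial>?M) \<le> B_const \<alpha> q u \<phi> \<omega>"
        unfolding K_def B_const_def using True by (rule SUP_upper)
      finally show ?thesis by (simp add: mult_right_mono)
    qed (simp add: F_def)
  qed
  also have "\<dots> = B_const \<alpha> q u \<phi> \<omega> * (\<integral>\<^sup>+ \<zeta>. ennreal (c * Im \<zeta> powr \<alpha>) * F \<zeta> \<partial>lborel)"
    by (rule nn_integral_cmult) measurable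
  also have "(\<integral>\<^sup>+ \<zeta>. ennreal (c * Im \<zeta> powr \<alpha>) * F \<zeta> \<partial>lborel)
      = (\<integral>\<^sup>+ \<zeta>. ennreal (9 * 3 powr (\<alpha> + 2) / ((\<alpha> + 1) * 2 powr \<alpha>)) * (bergman_density \<alpha> \<zeta> * F \<zeta>) \<partial>lborel)"
  proof (rule nn_integral_cong)
    fix \<zeta>
    show "ennreal (c * Im \<zeta> powr \<alpha>) * F \<zeta>
        = ennreal (9 * 3 powr (\<alpha> + 2) / ((\<alpha> + 1) * 2 powr \<alpha>)) * (bergman_density \<alpha> \<zeta> * F \<zeta>)"
    proof (cases "\<zeta> \<in> upper_half_plane")
      case True
      have "c * Im \<zeta> powr \<alpha> = 9 * 3 powr (\<alpha> + 2) / ((\<alpha> + 1) * 2 powr \<alpha>)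
          * (1 / pi * (\<alpha> + 1) * (2 * Im \<zeta>) powr \<alpha>)"
        using \<alpha> True by (simp add: c_def powr_mult upper_half_plane_def)
      then show ?thesis
        using \<alpha> True
        by (simp add: bergman_density_def ennreal_mult mult.assoc del: times_divide_eq_left times_divide_eq_right)
    qed (simp add: F_def)
  qed
  also have "\<dots> = ennreal (9 * 3 powr (\<alpha> + 2) / ((\<alpha> + 1) * 2 powr \<alpha>))
      * (\<integral>\<^sup>+ \<zeta>. bergman_density \<alpha> \<zeta> * F \<zeta> \<partial>lborel)"
    by (rule nn_integral_cmult) measurable
  also have "(\<integral>\<^sup>+ \<zeta>. bergman_density \<alpha> \<zeta> * F \<zeta> \<partial>lborel) = (\<integral>\<^sup>+ z. F z \<partial>?M)"
    by (rule nn_integral_bergman_measure[symmetric]) measurable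
  also have "\<dots> = (\<integral>\<^sup>+ z. ennreal (norm (f z) powr q) \<partial>?M)"
    by (rule nn_integral_cong) (simp add: F_def)
  finally show ?thesis by (simp add: mult_ac)
qed

section \<open>Powers of norms and interpolation of weights\<close>

lemma ennreal_powr_ennreal: "0 \<le> r \<Longrightarrow> ennreal_powr (ennreal r) p = ennreal (r powr p)"
  by (simp add: ennreal_powr_def)

lemma ennreal_powr_less_top_iff: "ennreal_powr x p < top \<longleftrightarrow> x < top"
  by (simp add: ennreal_powr_def less_top[symmetric])

lemma ennreal_powr_inverse: "0 < p \<Longrightarrow> ennreal_powr (ennreal_powr x (1 / p)) p = x"
  by (cases x) (simp_all add: ennreal_powr_def powr_powr)

lemma ennreal_powr_mono: "x \<le> y \<Longrightarrow> 0 \<le> p \<Longrightarrow> ennreal_powr x p \<le> ennreal_powr y p"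
  by (cases x; cases y) (auto simp: ennreal_powr_def top_unique intro!: ennreal_leI powr_mono2)

lemma bergman_norm_powr:
  "0 < p \<Longrightarrow> ennreal_powr (bergman_norm p \<alpha> f) p = (\<integral>\<^sup>+ z. ennreal (norm (f z) powr p) \<partial>bergman_measure \<alpha>)"
  by (simp add: bergman_norm_def ennreal_powr_inverse)

text \<open>
  Boundedness restated for \<open>q\<close>-th powers of norms, which are plain integrals. The constant may
  be taken nonnegative.
\<close>

lemma bounded_on_bergman_powr:
  assumes "bounded_on_bergman q \<alpha> T" "0 < q"
  obtains C :: real where "0 \<le> C"
    "\<And>f. f \<in> bergman_space q \<alpha> \<Longrightarrow>
      (\<integral>\<^sup>+ z. ennreal (norm (T f z) powr q) \<partial>bergman_measure \<alpha>)
        \<le> ennreal C * (\<integral>\<^sup>+ z. ennreal (norm (f z) powr q) \<partial>bergman_measure \<alpha>)"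
proof -
  obtain C where C: "\<And>f. f \<in> bergman_space q \<alpha> \<Longrightarrow> bergman_norm q \<alpha> (T f) \<le> ennreal C * bergman_norm q \<alpha> f"
    using assms(1) by (auto simp: bounded_on_bergman_def)
  show ?thesis
  proof (rule that[of "max C 0 powr q"])
    fix f assume f: "f \<in> bergman_space q \<alpha>"
    obtain n where n: "0 \<le> n" "bergman_norm q \<alpha> f = ennreal n"
      using f by (cases "bergman_norm q \<alpha> f") (auto simp: bergman_space_def)
    have "bergman_norm q \<alpha> (T f) \<le> ennreal C * ennreal n"
      using C[OF f] n by simp
    also have "\<dots> \<le> ennreal (max C 0) * ennreal n"
      by (intro mult_right_mono ennreal_leI) auto
    also have "\<dots> = ennreal (max C 0 * n)"
      using n by (simp add: ennreal_mult)
    finally have "bergman_norm q \<alpha> (T f) \<le> ennreal (max C 0 * n)" .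
    then have "ennreal_powr (bergman_norm q \<alpha> (T f)) q \<le> ennreal_powr (ennreal (max C 0 * n)) q"
      using assms(2) by (intro ennreal_powr_mono) auto
    also have "\<dots> = ennreal ((max C 0 * n) powr q)"
      using n by (intro ennreal_powr_ennreal) simp
    also have "\<dots> = ennreal (max C 0 powr q) * ennreal_powr (bergman_norm q \<alpha> f) q"
      using n by (simp add: ennreal_powr_ennreal powr_mult ennreal_mult)
    finally show "(\<integral>\<^sup>+ z. ennreal (norm (T f z) powr q) \<partial>bergman_measure \<alpha>)
        \<le> ennreal (max C 0 powr q) * (\<integral>\<^sup>+ z. ennreal (norm (f z) powr q) \<partial>bergman_measure \<alpha>)"
      using assms(2) by (simp add: bergman_norm_powr)
  qed simp
qed

text \<open>
  This plays the role of Hoelder's inequality with exponent \<open>s\<close>, with the sum of \<open>N1\<close> and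
  \<open>N2\<close> in place of a geometric mean. For every \<open>t > 0\<close> one has \<open>\<omega> \<le> t powr (s - 1) * \<omega> powr s + 1 / t\<close>: if
  \<open>t * \<omega> \<le> 1\<close> the second summand dominates, and otherwise the first does. Integrating against
  \<open>g\<close> and choosing \<open>t\<close> to balance the two terms gives the claim.
\<close>

lemma nn_integral_weight_interpolation:
  fixes g \<omega> :: "'a \<Rightarrow> real"
  assumes [measurable]: "g \<in> borel_measurable M" "\<omega> \<in> borel_measurable M"
    and nonneg: "\<And>x. x \<in> space M \<Longrightarrow> 0 \<le> g x" "\<And>x. x \<in> space M \<Longrightarrow> 0 \<le> \<omega> x"
    and s: "1 < s" and B: "B < \<infinity>"
    and weighted: "(\<integral>\<^sup>+ x. ennreal (g x * \<omega> x powr s) \<partial>M) \<le> B * N1"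
    and unweighted: "(\<integral>\<^sup>+ x. ennreal (g x) \<partial>M) \<le> N2"
  shows "(\<integral>\<^sup>+ x. ennreal (g x * \<omega> x) \<partial>M) \<le> ennreal_powr B (1 / s) * (N1 + N2)"
proof (cases "B = 0")
  case True
  then have "(\<integral>\<^sup>+ x. ennreal (g x * \<omega> x powr s) \<partial>M) = 0"
    using weighted by simp
  then have "AE x in M. ennreal (g x * \<omega> x powr s) = 0"
    by (subst (asm) nn_integral_0_iff_AE) measurable
  then have "AE x in M. ennreal (g x * \<omega> x) = 0"
  proof (rule AE_mp, intro AE_I2 impI)
    fix x assume x: "x \<in> space M" "ennreal (g x * \<omega> x powr s) = 0"
    have "0 \<le> g x * \<omega> x powr s"
      using nonneg[OF x(1)] by (intro mult_nonneg_nonneg) auto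
    with x(2) have "g x * \<omega> x powr s = 0"
      by (metis ennreal_eq_0_iff order_antisym)
    then show "ennreal (g x * \<omega> x) = 0" by auto
  qed
  then have "(\<integral>\<^sup>+ x. ennreal (g x * \<omega> x) \<partial>M) = 0"
    by (subst nn_integral_0_iff_AE) measurable
  then show ?thesis by simp
next
  case False
  then obtain b where b: "0 < b" "B = ennreal b"
    using B by (cases B) auto
  \<comment> \<open>This choice makes the coefficients of both terms equal, to \<open>b powr (1 / s)\<close>.\<close>
  define t where "t = b powr (- (1 / s))"
  have t: "0 < t" using b by (simp add: t_def)
  have t1: "1 / t = b powr (1 / s)"
    by (simp add: t_def powr_minus field_simps)
  have "t powr (s - 1) * b = b powr (- (1 / s) * (s - 1)) * b powr 1"
    using b by (simp add: t_def powr_powr)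
  also have "\<dots> = b powr (- (1 / s) * (s - 1) + 1)"
    by (simp only: powr_add)
  also have "- (1 / s) * (s - 1) + 1 = 1 / s"
    using s by (simp add: field_simps)
  finally have ts: "t powr (s - 1) * b = b powr (1 / s)" .
  have "g x * \<omega> x \<le> t powr (s - 1) * (g x * \<omega> x powr s) + 1 / t * g x" if x: "x \<in> space M" for x
  proof -
    have "\<omega> x \<le> t powr (s - 1) * \<omega> x powr s + 1 / t"
    proof (cases "\<omega> x \<le> 1 / t")
      case False
      then have *: "1 \<le> t * \<omega> x" "0 < \<omega> x"
        using t by (auto simp: field_simps less_trans[OF _ False[unfolded not_le]])
      have "1 * \<omega> x \<le> (t * \<omega> x) powr (s - 1) * \<omega> x"
        using * s by (intro mult_right_mono ge_one_powr_ge_zero) auto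
      also have "\<dots> = t powr (s - 1) * \<omega> x powr s"
        using * t by (simp add: powr_mult powr_diff)
      moreover have "0 \<le> 1 / t" using t by simp
      ultimately show ?thesis by linarith
    qed (simp add: add_increasing)
    then have "g x * \<omega> x \<le> g x * (t powr (s - 1) * \<omega> x powr s + 1 / t)"
      using nonneg[OF x] by (intro mult_left_mono)
    then show ?thesis by (simp add: algebra_simps)
  qed
  then have "(\<integral>\<^sup>+ x. ennreal (g x * \<omega> x) \<partial>M)
      \<le> (\<integral>\<^sup>+ x. ennreal (t powr (s - 1)) * ennreal (g x * \<omega> x powr s) + ennreal (1 / t) * ennreal (g x) \<partial>M)"
    using nonneg t
    by (intro nn_integral_mono) (simp add: ennreal_mult'[symmetric] ennreal_plus[symmetric] ennreal_leI del: ennreal_plus)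
  also have "\<dots> = ennreal (t powr (s - 1)) * (\<integral>\<^sup>+ x. ennreal (g x * \<omega> x powr s) \<partial>M)
      + ennreal (1 / t) * (\<integral>\<^sup>+ x. ennreal (g x) \<partial>M)"
    by (simp add: nn_integral_add nn_integral_cmult)
  also have "\<dots> \<le> ennreal (t powr (s - 1)) * (B * N1) + ennreal (1 / t) * N2"
    by (intro add_mono mult_left_mono weighted unweighted) simp_all
  also have "\<dots> = ennreal (t powr (s - 1) * b) * N1 + ennreal (1 / t) * N2"
    using b by (simp add: ennreal_mult mult.assoc)
  also have "\<dots> = ennreal_powr B (1 / s) * (N1 + N2)"
    using b by (simp add: ts t1 ennreal_powr_ennreal distrib_left)
  finally show ?thesis .
qed

section \<open>Test functions and Carleson tents\<close>

lemma upper_half_plane_affine: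
  "0 < c \<Longrightarrow> of_real x + c *\<^sub>R z \<in> upper_half_plane \<longleftrightarrow> z \<in> upper_half_plane"
  by (simp add: upper_half_plane_def zero_less_mult_iff)

lemma bergman_density_affine:
  assumes c: "0 < c"
  shows "bergman_density \<alpha> (of_real x + c *\<^sub>R z) = ennreal (c powr \<alpha>) * bergman_density \<alpha> z"
proof (cases "z \<in> upper_half_plane")
  case True
  then have "(2 * Im (of_real x + c *\<^sub>R z)) powr \<alpha> = c powr \<alpha> * (2 * Im z) powr \<alpha>"
    using c by (simp add: upper_half_plane_def powr_mult[symmetric] mult_ac)
  then show ?thesis
    using c True
    by (simp add: bergman_density_def upper_half_plane_affine ennreal_mult''[symmetric] ennreal_mult'[symmetric] mult_ac)
qed (use c in \<open>simp add: bergman_density_def upper_half_plane_affine\<close>)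

text \<open>
  The maps \<open>z \<mapsto> x + c z\<close> with \<open>c > 0\<close> preserve the half-plane and scale area by \<open>c\<^sup>2\<close> and the
  density by \<open>c powr \<alpha>\<close>. Taking \<open>x = Re a\<close> and \<open>c = Im a\<close> carries \<open>\<i>\<close> to \<open>a\<close>, which
  reduces estimates that are uniform in \<open>a\<close> to the case \<open>a = \<i>\<close>.
\<close>

lemma nn_integral_bergman_affine:
  fixes h :: "complex \<Rightarrow> ennreal"
  assumes h: "(\<lambda>z. indicator upper_half_plane z * h z) \<in> borel_measurable borel" and c: "0 < c"
  shows "(\<integral>\<^sup>+ z. h z \<partial>bergman_measure \<alpha>)
    = ennreal (c powr (\<alpha> + 2)) * (\<integral>\<^sup>+ z. h (of_real x + c *\<^sub>R z) \<partial>bergman_measure \<alpha>)"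
proof -
  define H where "H = (\<lambda>z. indicator upper_half_plane z * h z)"
  have [measurable]: "H \<in> borel_measurable borel"
    using h by (simp add: H_def)
  have dH: "bergman_density \<alpha> z * h z = bergman_density \<alpha> z * H z" for z
    by (simp add: H_def bergman_density_def indicator_def)
  have "(\<lambda>z. H (of_real x + c *\<^sub>R z)) \<in> borel_measurable borel"
    by measurable
  then have h': "(\<lambda>z. indicator upper_half_plane z * h (of_real x + c *\<^sub>R z)) \<in> borel_measurable borel"
    using c by (simp add: H_def indicator_def upper_half_plane_affine)
  have dH': "bergman_density \<alpha> z * h (of_real x + c *\<^sub>R z) = bergman_density \<alpha> z * H (of_real x + c *\<^sub>R z)" for z
    using c by (simp add: H_def bergman_density_def indicator_def upper_half_plane_affine)
  have "(\<integral>\<^sup>+ z. h z \<partial>bergman_measure \<alpha>) = (\<integral>\<^sup>+ z. bergman_density \<alpha> z * H z \<partial>lborel)"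
    using h by (simp add: nn_integral_bergman_measure dH)
  also have "\<dots> = ennreal (c\<^sup>2) * (\<integral>\<^sup>+ z. ennreal (c powr \<alpha>) * (bergman_density \<alpha> z * H (of_real x + c *\<^sub>R z)) \<partial>lborel)"
    by (subst nn_integral_lborel_affine[where c = c and t = "of_real x"])
       (use c in \<open>simp_all add: bergman_density_affine mult.assoc\<close>)
  also have "\<dots> = ennreal (c\<^sup>2) * ennreal (c powr \<alpha>) * (\<integral>\<^sup>+ z. bergman_density \<alpha> z * H (of_real x + c *\<^sub>R z) \<partial>lborel)"
    by (subst nn_integral_cmult) (simp_all add: mult.assoc)
  also have "ennreal (c\<^sup>2) * ennreal (c powr \<alpha>) = ennreal (c powr (\<alpha> + 2))"
    using c by (simp add: ennreal_mult''[symmetric] powr_add powr_numeral mult.commute)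
  finally show ?thesis
    using h' by (simp add: nn_integral_bergman_measure dH')
qed

lemma nn_integral_inverse_1_plus_square_finite:
  "(\<integral>\<^sup>+ x. ennreal (1 / (1 + x\<^sup>2)) \<partial>lborel) < \<infinity>"
proof -
  define H where "H = (\<integral>\<^sup>+ x. ennreal (1 / (1 + x\<^sup>2)) * indicator {0..} x \<partial>lborel)"
  have "H = ennreal (pi / 2 - arctan 0)"
    unfolding H_def
  proof (rule nn_integral_FTC_atLeast)
    show "DERIV arctan x :> 1 / (1 + x\<^sup>2)" for x
      using DERIV_arctan[of x] by (simp add: field_simps)
  qed (auto intro: tendsto_arctan_at_top)
  then have H: "H < \<infinity>" by simp
  have "(\<integral>\<^sup>+ x. ennreal (1 / (1 + x\<^sup>2)) * indicator {..0} x \<partial>lborel) = H"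
    unfolding H_def by (subst nn_integral_real_affine[where c = "-1" and t = 0]) (auto simp: indicator_def intro!: nn_integral_cong)
  then have "(\<integral>\<^sup>+ x. ennreal (1 / (1 + x\<^sup>2)) * indicator {0..} x + ennreal (1 / (1 + x\<^sup>2)) * indicator {..0} x \<partial>lborel) = H + H"
    by (subst nn_integral_add) (simp_all add: H_def)
  moreover have "(\<integral>\<^sup>+ x. ennreal (1 / (1 + x\<^sup>2)) \<partial>lborel)
      \<le> (\<integral>\<^sup>+ x. ennreal (1 / (1 + x\<^sup>2)) * indicator {0..} x + ennreal (1 / (1 + x\<^sup>2)) * indicator {..0} x \<partial>lborel)"
    by (rule nn_integral_mono) (auto simp: indicator_def)
  ultimately show ?thesis
    using H by (simp add: order_le_less_trans)
qed

text \<open>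
  Near \<open>0\<close> the factor \<open>y powr \<alpha>\<close> is integrable since \<open>\<alpha> > -1\<close>; beyond \<open>1\<close> the
  integrand is at most \<open>y powr (- 2)\<close>.
\<close>

lemma nn_integral_powr_beta_finite:
  fixes \<alpha> :: real
  assumes \<alpha>: "-1 < \<alpha>"
  shows "(\<integral>\<^sup>+ y. indicator {0<..} y * ennreal (y powr \<alpha> * (1 + y) powr (- (\<alpha> + 2))) \<partial>lborel) < \<infinity>"
proof -
  have "(\<integral>\<^sup>+ y. indicator {0<..} y * ennreal (y powr \<alpha> * (1 + y) powr (- (\<alpha> + 2))) \<partial>lborel)
      \<le> (\<integral>\<^sup>+ y. ennreal (indicator {0..1} y * y powr \<alpha>) + ennreal (indicator {1..} y * y powr (- 2)) \<partial>lborel)"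
  proof (rule nn_integral_mono)
    fix y :: real
    consider "y \<le> 0" | "0 < y" "y \<le> 1" | "1 < y" by linarith
    then show "indicator {0<..} y * ennreal (y powr \<alpha> * (1 + y) powr (- (\<alpha> + 2)))
        \<le> ennreal (indicator {0..1} y * y powr \<alpha>) + ennreal (indicator {1..} y * y powr (- 2))"
    proof cases
      case 2
      have "(1 + y) powr (- (\<alpha> + 2)) \<le> 1"
        using 2 \<alpha> powr_mono[of "- (\<alpha> + 2)" 0 "1 + y"] by simp
      then have "y powr \<alpha> * (1 + y) powr (- (\<alpha> + 2)) \<le> y powr \<alpha>"
        by (simp add: mult_left_le)
      then show ?thesis
        using 2 by (auto intro!: add_increasing2 ennreal_leI)
    next
      case 3
      have "(1 + y) powr (- (\<alpha> + 2)) \<le> y powr (- (\<alpha> + 2))"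
        using 3 \<alpha> by (intro powr_mono2') auto
      then have "y powr \<alpha> * (1 + y) powr (- (\<alpha> + 2)) \<le> y powr \<alpha> * y powr (- (\<alpha> + 2))"
        by (intro mult_left_mono) auto
      also have "\<dots> = y powr (- 2)"
        by (simp add: powr_add[symmetric])
      finally show ?thesis
        using 3 by (auto intro!: add_increasing ennreal_leI)
    qed simp
  qed
  also have "\<dots> = (\<integral>\<^sup>+ y. ennreal (indicator {0..1} y * y powr \<alpha>) \<partial>lborel)
      + (\<integral>\<^sup>+ y. ennreal (indicator {1..} y * y powr (- 2)) \<partial>lborel)"
    by (rule nn_integral_add) measurable
  also have "(\<integral>\<^sup>+ y. ennreal (indicator {0..1} y * y powr \<alpha>) \<partial>lborel) = ennreal (1 powr (\<alpha> + 1) / (\<alpha> + 1))"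
    using \<alpha> by (intro nn_integral_has_integral_lebesgue has_integral_powr_from_0) auto
  also have "(\<integral>\<^sup>+ y. ennreal (indicator {1..} y * y powr (- 2)) \<partial>lborel) = ennreal (- (1 powr (- 2 + 1)) / (- 2 + 1))"
    by (intro nn_integral_has_integral_lebesgue has_integral_powr_to_inf) auto
  finally show ?thesis
    by (rule order_le_less_trans) simp
qed

text \<open>
  With \<open>z = x + i y\<close> the integrand, density included, is dominated by a product of functions of
  \<open>x\<close> and \<open>y\<close>: one factor \<open>norm (z + \<i>) powr (- 2) \<le> 1 / (1 + x\<^sup>2)\<close> pays for the horizontal
  direction and the remaining decay \<open>(1 + y) powr (- (\<alpha> + 2))\<close> pays for the vertical one.
\<close>

lemma nn_integral_bergman_kernel_finite:
  assumes \<alpha>: "-1 < \<alpha>" and m: "\<alpha> + 4 \<le> m"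
  shows "(\<integral>\<^sup>+ z. ennreal (norm (z + \<i>) powr (- m)) \<partial>bergman_measure \<alpha>) < \<infinity>"
proof -
  define c where "c = 1 / pi * (\<alpha> + 1) * 2 powr \<alpha>"
  have c: "0 \<le> c" using \<alpha> by (simp add: c_def)
  define p where "p = (\<lambda>x::real. ennreal (1 / (1 + x\<^sup>2)))"
  define r where "r = (\<lambda>y. indicator {0<..} y * ennreal (y powr \<alpha> * (1 + y) powr (- (\<alpha> + 2))))"
  have [measurable]: "p \<in> borel_measurable borel" "r \<in> borel_measurable borel"
    unfolding p_def r_def by measurable
  have "(\<integral>\<^sup>+ z. ennreal (norm (z + \<i>) powr (- m)) \<partial>bergman_measure \<alpha>)
      = (\<integral>\<^sup>+ z. bergman_density \<alpha> z * ennreal (norm (z + \<i>) powr (- m)) \<partial>lborel)"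
    by (rule nn_integral_bergman_measure) measurable
  also have "\<dots> \<le> (\<integral>\<^sup>+ z. ennreal c * (p (Re z) * r (Im z)) \<partial>lborel)"
  proof (rule nn_integral_mono)
    fix z
    show "bergman_density \<alpha> z * ennreal (norm (z + \<i>) powr (- m)) \<le> ennreal c * (p (Re z) * r (Im z))"
    proof (cases "z \<in> upper_half_plane")
      case True
      then have y: "0 < Im z" by (simp add: upper_half_plane_def)
      define n where "n = norm (z + \<i>)"
      have "\<bar>Im (z + \<i>)\<bar> \<le> n"
        unfolding n_def by (rule abs_Im_le_cmod)
      then have n: "1 + Im z \<le> n" using y by simp
      have "1 + (Re z)\<^sup>2 \<le> n\<^sup>2"
      proof -
        have "n\<^sup>2 = (Re z)\<^sup>2 + (1 + Im z)\<^sup>2"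
          by (simp add: n_def norm_complex_def add.commute)
        moreover have "1 \<le> (1 + Im z)\<^sup>2"
          using y by (intro one_le_power) simp
        ultimately show ?thesis by linarith
      qed
      then have n2: "n powr (- 2) \<le> 1 / (1 + (Re z)\<^sup>2)"
        using n y by (simp add: powr_minus powr_numeral divide_inverse le_imp_inverse_le add_pos_nonneg)
      have "n powr (- m) \<le> n powr (- 2 + - (\<alpha> + 2))"
        using n y m by (intro powr_mono) auto
      also have "\<dots> = n powr (- 2) * n powr (- (\<alpha> + 2))"
        by (rule powr_add)
      also have "\<dots> \<le> 1 / (1 + (Re z)\<^sup>2) * (1 + Im z) powr (- (\<alpha> + 2))"
        using n y \<alpha> by (intro mult_mono n2 powr_mono2') auto
      finally have "(c * Im z powr \<alpha>) * n powr (- m)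
          \<le> (c * Im z powr \<alpha>) * (1 / (1 + (Re z)\<^sup>2) * (1 + Im z) powr (- (\<alpha> + 2)))"
        using c by (intro mult_left_mono) auto
      moreover have "1 / pi * (\<alpha> + 1) * (2 * Im z) powr \<alpha> = c * Im z powr \<alpha>"
        using y by (simp add: c_def powr_mult)
      ultimately show ?thesis
        using True y c \<alpha>
        by (simp add: bergman_density_def p_def r_def n_def[symmetric] ennreal_mult'[symmetric]
            ennreal_mult''[symmetric] ennreal_leI mult_ac del: times_divide_eq_left times_divide_eq_right)
    qed (simp add: bergman_density_def)
  qed
  also have "\<dots> = (\<integral>\<^sup>+ x. \<integral>\<^sup>+ y. ennreal c * (p x * r y) \<partial>lborel \<partial>lborel)"
    by (subst nn_integral_lborel_complex) simp_all
  also have "\<dots> = ennreal c * ((\<integral>\<^sup>+ x. p x \<partial>lborel) * (\<integral>\<^sup>+ y. r y \<partial>lborel))"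
    by (simp add: nn_integral_cmult nn_integral_multc)
  also have "\<dots> < \<infinity>"
    using nn_integral_inverse_1_plus_square_finite nn_integral_powr_beta_finite[OF \<alpha>]
    by (simp add: p_def r_def ennreal_mult_less_top)
  finally show ?thesis .
qed

lemma borel_measurable_bergman_kernel:
  "(\<lambda>z. ennreal (norm (z + \<i>) powr (- m))) \<in> borel_measurable (bergman_measure \<alpha>)"
  unfolding measurable_bergman_measure_cong
  by (intro measurable_restrict_space1 measurable_completion) measurable

lemma nn_integral_bergman_kernel:
  assumes a: "a \<in> upper_half_plane"
  shows "(\<integral>\<^sup>+ z. ennreal (norm (z - cnj a) powr (- m)) \<partial>bergman_measure \<alpha>)
    = ennreal (Im a powr (\<alpha> + 2 - m)) * (\<integral>\<^sup>+ z. ennreal (norm (z + \<i>) powr (- m)) \<partial>bergman_measure \<alpha>)"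
proof -
  have y: "0 < Im a" using a by (simp add: upper_half_plane_def)
  have eq: "norm (of_real (Re a) + Im a *\<^sub>R z - cnj a) powr (- m) = Im a powr (- m) * norm (z + \<i>) powr (- m)" for z
  proof -
    have "of_real (Re a) + Im a *\<^sub>R z - cnj a = Im a *\<^sub>R (z + \<i>)"
      by (simp add: complex_eq_iff algebra_simps)
    then show ?thesis using y by (simp add: powr_mult)
  qed
  have "(\<integral>\<^sup>+ z. ennreal (norm (of_real (Re a) + Im a *\<^sub>R z - cnj a) powr (- m)) \<partial>bergman_measure \<alpha>)
      = ennreal (Im a powr (- m)) * (\<integral>\<^sup>+ z. ennreal (norm (z + \<i>) powr (- m)) \<partial>bergman_measure \<alpha>)"
    unfolding eq by (simp add: ennreal_mult' nn_integral_cmult[OF borel_measurable_bergman_kernel])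
  then show ?thesis
    by (subst nn_integral_bergman_affine[OF _ y, where x = "Re a"])
       (measurable, simp add: mult.assoc[symmetric] ennreal_mult''[symmetric] powr_add[symmetric])
qed

lemma measurable_carleson_tent [measurable]: "carleson_tent a \<in> sets borel"
proof -
  have "carleson_tent a = upper_half_plane \<inter> {z \<in> space borel. \<bar>Re z - Re a\<bar> \<le> Im a / 2 \<and> 0 < Im z \<and> Im z < Im a}"
    by (auto simp: carleson_tent_def)
  also have "\<dots> \<in> sets borel"
    by measurable
  finally show ?thesis .
qed

lemma carleson_tent_subset: "carleson_tent a \<subseteq> upper_half_plane"
  by (auto simp: carleson_tent_def)

lemma measurable_indicator_carleson_tent:
  "(\<lambda>z. indicator upper_half_plane z * indicator (carleson_tent a) z :: ennreal) \<in> borel_measurable borel"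
  by measurable

lemma emeasure_bergman_tent_eq_nn_integral:
  "emeasure (bergman_measure \<alpha>) (carleson_tent a) = (\<integral>\<^sup>+ z. indicator (carleson_tent a) z \<partial>bergman_measure \<alpha>)"
  by (rule nn_integral_indicator[symmetric])
     (use carleson_tent_subset[of a] in \<open>auto simp: sets_bergman_measure sets_restrict_space_iff upper_half_plane_borel\<close>)

lemma emeasure_carleson_tent:
  assumes a: "a \<in> upper_half_plane"
  shows "emeasure (bergman_measure \<alpha>) (carleson_tent a)
    = ennreal (Im a powr (\<alpha> + 2)) * emeasure (bergman_measure \<alpha>) (carleson_tent \<i>)"
proof -
  have y: "0 < Im a" using a by (simp add: upper_half_plane_def)
  have "\<bar>Im a * t\<bar> \<le> Im a / 2 \<longleftrightarrow> \<bar>t\<bar> \<le> 1 / 2" for t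
    using y by (simp add: abs_mult field_simps)
  then have "indicator (carleson_tent a) (of_real (Re a) + Im a *\<^sub>R z) = (indicator (carleson_tent \<i>) z :: ennreal)" for z
    using y by (auto simp: carleson_tent_def indicator_def upper_half_plane_def zero_less_mult_iff)
  then show ?thesis
    unfolding emeasure_bergman_tent_eq_nn_integral
    by (subst nn_integral_bergman_affine[OF measurable_indicator_carleson_tent y, where x = "Re a"]) simp
qed

lemma emeasure_carleson_tent_pos:
  assumes \<alpha>: "-1 < \<alpha>"
  shows "0 < emeasure (bergman_measure \<alpha>) (carleson_tent \<i>)"
proof (rule ccontr)
  assume "\<not> 0 < emeasure (bergman_measure \<alpha>) (carleson_tent \<i>)"
  then have "(\<integral>\<^sup>+ z. bergman_density \<alpha> z * indicator (carleson_tent \<i>) z \<partial>lborel) = 0"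
    unfolding emeasure_bergman_tent_eq_nn_integral
      nn_integral_bergman_measure[OF measurable_indicator_carleson_tent]
    by (simp only: not_gr_zero)
  then have "AE z in lborel. bergman_density \<alpha> z * indicator (carleson_tent \<i>) z = 0"
    by (subst (asm) nn_integral_0_iff_AE) measurable
  then have "AE z in lborel. z \<notin> box (Complex (- 1 / 2) 0) (Complex (1 / 2) 1)"
  proof (rule AE_mp, intro AE_I2 impI notI)
    fix z
    assume 0: "bergman_density \<alpha> z * indicator (carleson_tent \<i>) z = 0"
      and "z \<in> box (Complex (- 1 / 2) 0) (Complex (1 / 2) 1)"
    then have z: "- 1 / 2 < Re z" "Re z < 1 / 2" "0 < Im z" "Im z < 1"
      by (auto simp: box_def Basis_complex_def inner_complex_def)
    then have "z \<in> carleson_tent \<i>"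
      by (auto simp: carleson_tent_def upper_half_plane_def)
    moreover have "0 < 1 / pi * (\<alpha> + 1) * (2 * Im z) powr \<alpha>"
      using z \<alpha> by (intro mult_pos_pos) auto
    ultimately show False
      using 0 z by (simp add: bergman_density_def upper_half_plane_def ennreal_eq_0_iff)
  qed
  then have "emeasure lborel (box (Complex (- 1 / 2) 0) (Complex (1 / 2) 1)) = 0"
    by (subst (asm) AE_iff_measurable[OF _ refl]) auto
  then show False
    by (simp add: emeasure_lborel_box_eq Basis_complex_def inner_complex_def)
qed

text \<open>
  On the tent at \<open>a\<close> one has \<open>norm (z - cnj a) \<le> 3 * Im a\<close>. With \<open>m = k * q\<close> the right side is
  a multiple of the \<open>q\<close>-th power of the modulus of the test function \<open>z \<mapsto> 1 / (z - cnj a) ^ k\<close>.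
\<close>

lemma indicator_carleson_tent_le:
  assumes a: "a \<in> upper_half_plane" and m: "0 \<le> m"
  shows "indicator (carleson_tent a) z \<le> (3 * Im a) powr m * norm (z - cnj a) powr (- m)"
proof (cases "z \<in> carleson_tent a")
  case True
  have y: "0 < Im a" using a by (simp add: upper_half_plane_def)
  have z: "\<bar>Re z - Re a\<bar> \<le> Im a / 2" "0 < Im z" "Im z < Im a"
    using True by (auto simp: carleson_tent_def)
  have "norm (z - cnj a) \<le> \<bar>Re (z - cnj a)\<bar> + \<bar>Im (z - cnj a)\<bar>"
    by (rule cmod_le)
  also have "\<dots> \<le> 3 * Im a" using z y by simp
  finally have "norm (z - cnj a) powr m \<le> (3 * Im a) powr m"
    using m by (intro powr_mono2) auto
  moreover have "z - cnj a \<noteq> 0"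
    using z y by (auto simp: complex_eq_iff)
  ultimately show ?thesis
    using True by (simp add: powr_minus field_simps)
qed simp

section \<open>The weighted norm estimate and its Carleson measure\<close>

theorem theorem4p9:
  fixes q q' s s' \<alpha> :: real and u \<phi> :: "complex \<Rightarrow> complex"
  assumes "q > 1"
    and "1 / q + 1 / q' = 1"
    and "1 < s" and "s < q'"
    and "1 / s + 1 / s' = 1"
    and "\<alpha> > -1"
    and "u holomorphic_on upper_half_plane"
    and "\<phi> holomorphic_on upper_half_plane"
    and "\<phi> ` upper_half_plane \<subseteq> upper_half_plane"
    and "bounded_on_bergman q \<alpha> (weighted_comp u \<phi>)"
  shows "(\<exists>C::real. C > 0 \<and>
            (\<forall>\<omega>. is_weight \<omega> \<and> (\<lambda>z. \<omega> z powr s') \<in> B_class \<alpha> q u \<phi> \<longrightarrow>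
              (\<forall>f \<in> bergman_space q \<alpha>.
                (\<integral>\<^sup>+ z. ennreal (norm (u z) powr q * norm (f (\<phi> z)) powr q * \<omega> z)
                   \<partial>bergman_measure \<alpha>)
                \<le> ennreal C * ennreal_powr (B_const \<alpha> q u \<phi> (\<lambda>z. \<omega> z powr s')) (1 / s')
                    * ennreal_powr (bergman_norm q \<alpha> f) q)))
       \<and> (\<forall>\<omega>. is_weight \<omega> \<and> (\<lambda>z. \<omega> z powr s') \<in> B_class \<alpha> q u \<phi> \<longrightarrow>
            one_carleson \<alpha> (pullback_measure u \<phi> q \<omega> \<alpha>))"
proof -
  note q = \<open>q > 1\<close> and \<alpha> = \<open>\<alpha> > -1\<close> and u = \<open>u holomorphic_on upper_half_plane\<close>
    and \<phi> = \<open>\<phi> holomorphic_on upper_half_plane\<close> \<open>\<phi> ` upper_half_plane \<subseteq> upper_half_plane\<close>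
  let ?M = "bergman_measure \<alpha>"
  let ?N = "\<lambda>f. \<integral>\<^sup>+ z. ennreal (norm (f z) powr q) \<partial>?M"
  let ?B = "\<lambda>\<omega>. B_const \<alpha> q u \<phi> (\<lambda>z. \<omega> z powr s')"
  have "1 / s' = 1 - 1 / s" "0 < 1 - 1 / s" "1 - 1 / s < 1"
    using \<open>1 < s\<close> \<open>1 / s + 1 / s' = 1\<close> by (auto simp: field_simps)
  then have "0 < 1 / s'" "1 / s' < 1"
    by simp_all
  then have s': "1 < s'"
    by (simp add: divide_less_eq split: if_splits)
  obtain C\<^sub>0 where C\<^sub>0: "0 \<le> C\<^sub>0"
    "\<And>f. f \<in> bergman_space q \<alpha> \<Longrightarrow> ?N (weighted_comp u \<phi> f) \<le> ennreal C\<^sub>0 * ?N f"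
    using bounded_on_bergman_powr[OF \<open>bounded_on_bergman q \<alpha> (weighted_comp u \<phi>)\<close>] q by auto
  define C\<^sub>1 where "C\<^sub>1 = 9 * 3 powr (\<alpha> + 2) / ((\<alpha> + 1) * 2 powr \<alpha>)"
  have C\<^sub>1: "0 < C\<^sub>1" using \<alpha> by (simp add: C\<^sub>1_def)
  have main: "(\<integral>\<^sup>+ z. ennreal (norm (u z) powr q * norm (f (\<phi> z)) powr q * \<omega> z) \<partial>?M)
      \<le> ennreal (C\<^sub>1 + C\<^sub>0) * ennreal_powr (?B \<omega>) (1 / s') * ?N f"
    if \<omega>: "is_weight \<omega>" "(\<lambda>z. \<omega> z powr s') \<in> B_class \<alpha> q u \<phi>" and f: "f \<in> bergman_space q \<alpha>" for \<omega> f
  proof -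
    have f_hol: "f holomorphic_on upper_half_plane"
      using f by (simp add: bergman_space_def)
    then have [measurable]: "(\<lambda>z. f (\<phi> z)) \<in> borel_measurable ?M"
      using \<phi> by (rule borel_measurable_bergman_comp)
    have [measurable]: "u \<in> borel_measurable ?M"
      using u by (rule holomorphic_measurable_bergman)
    have \<omega>_meas [measurable]: "\<omega> \<in> borel_measurable ?M"
      using \<omega>(1) by (simp add: is_weight_def measurable_bergman_measure_cong)
    have \<omega>_powr: "(\<lambda>z. \<omega> z powr s') \<in> borel_measurable (lebesgue_on upper_half_plane)"
      using \<omega>(2) by (simp add: B_class_def is_weight_def)
    have "(\<integral>\<^sup>+ z. ennreal (norm (u z) powr q * norm (f (\<phi> z)) powr q * \<omega> z) \<partial>?M)
        \<le> ennreal_powr (?B \<omega>) (1 / s') * (ennreal C\<^sub>1 * ?N f + ennreal C\<^sub>0 * ?N f)"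
    proof (rule nn_integral_weight_interpolation)
      show "(\<integral>\<^sup>+ z. ennreal (norm (u z) powr q * norm (f (\<phi> z)) powr q * \<omega> z powr s') \<partial>?M)
          \<le> ?B \<omega> * (ennreal C\<^sub>1 * ?N f)"
        using nn_integral_comp_le_B_const[OF u \<phi> \<omega>_powr _ f_hol _ \<alpha>, of q] q
        by (simp add: C\<^sub>1_def mult_ac)
      show "(\<integral>\<^sup>+ z. ennreal (norm (u z) powr q * norm (f (\<phi> z)) powr q) \<partial>?M) \<le> ennreal C\<^sub>0 * ?N f"
        using C\<^sub>0(2)[OF f] by (simp add: weighted_comp_def norm_mult powr_mult)
      show "?B \<omega> < \<infinity>"
        using \<omega>(2) by (simp add: B_class_def)
    qed (use \<omega>(1) s' in \<open>auto simp: is_weight_def\<close>)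
    then show ?thesis
      using C\<^sub>0(1) C\<^sub>1 by (simp add: distrib_left distrib_right mult_ac)
  qed
  have carleson: "one_carleson \<alpha> (pullback_measure u \<phi> q \<omega> \<alpha>)"
    if \<omega>: "is_weight \<omega>" "(\<lambda>z. \<omega> z powr s') \<in> B_class \<alpha> q u \<phi>" for \<omega>
  proof -
    \<comment> \<open>An integer power of \<open>z - cnj a\<close> avoids branches.\<close>
    define k where "k = nat \<lceil>\<alpha> + 4\<rceil>"
    define m where "m = real k * q"
    have "\<alpha> + 4 \<le> real k"
      using \<alpha> by (simp add: k_def)
    also have "\<dots> \<le> m"
      using q mult_left_mono[of 1 q "real k"] by (simp add: m_def)
    finally have m: "\<alpha> + 4 \<le> m" .
    then have m0: "0 \<le> m" using \<alpha> by simp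
    define J where "J = (\<integral>\<^sup>+ z. ennreal (norm (z + \<i>) powr (- m)) \<partial>?M)"
    have J: "J < \<infinity>"
      unfolding J_def using \<alpha> m by (rule nn_integral_bergman_kernel_finite)
    define A where "A = emeasure ?M (carleson_tent \<i>)"
    have A0: "0 < A"
      unfolding A_def using \<alpha> by (rule emeasure_carleson_tent_pos)
    define b where "b = ennreal_powr (?B \<omega>) (1 / s')"
    have b: "b < \<infinity>"
      using \<omega>(2) by (simp add: b_def B_class_def ennreal_powr_less_top_iff)
    define D where "D = ennreal (3 powr m) * (ennreal (C\<^sub>1 + C\<^sub>0) * b * J)"
    have D: "D < \<infinity>"
      using b J by (simp add: D_def ennreal_mult_less_top)
    have tent: "emeasure (pullback_measure u \<phi> q \<omega> \<alpha>) (carleson_tent a)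
        \<le> ennreal (Im a powr (\<alpha> + 2)) * D" if a: "a \<in> upper_half_plane" for a
    proof -
      have y: "0 < Im a" using a by (simp add: upper_half_plane_def)
      \<comment> \<open>The first part, applied to this test function, bounds the measure of the tent at \<open>a\<close>.\<close>
      define f where "f = (\<lambda>z. 1 / (z - cnj a) ^ k)"
      have nz: "z - cnj a \<noteq> 0" if "z \<in> upper_half_plane" for z
        using that y by (auto simp: complex_eq_iff upper_half_plane_def)
      have f_powr: "norm (f z) powr q = norm (z - cnj a) powr (- m)" if "z \<in> upper_half_plane" for z
        using nz[OF that]
        by (simp add: f_def norm_divide norm_power powr_realpow[symmetric] powr_minus powr_powr m_def
            powr_divide inverse_eq_divide)
      have Nf: "?N f = ennreal (Im a powr (\<alpha> + 2 - m)) * J"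
        unfolding J_def nn_integral_bergman_kernel[OF a, symmetric]
        by (rule nn_integral_cong) (simp add: f_powr)
      have f: "f \<in> bergman_space q \<alpha>"
      proof -
        have "f holomorphic_on upper_half_plane"
          unfolding f_def using nz by (intro holomorphic_intros) auto
        moreover have "?N f < \<infinity>"
          using J by (simp add: Nf ennreal_mult_less_top)
        ultimately show ?thesis
          by (simp add: bergman_space_def bergman_norm_def ennreal_powr_less_top_iff)
      qed
      have tent_sets: "carleson_tent a \<in> sets (restrict_space borel upper_half_plane)"
        using carleson_tent_subset[of a] by (simp add: sets_restrict_space_iff upper_half_plane_borel)
      have "emeasure (pullback_measure u \<phi> q \<omega> \<alpha>) (carleson_tent a)
          = (\<integral>\<^sup>+ z. indicator (carleson_tent a) z \<partial>pullback_measure u \<phi> q \<omega> \<alpha>)"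
        using tent_sets by (simp add: pullback_measure_def)
      also have "\<dots> = (\<integral>\<^sup>+ z. ennreal (norm (u z) powr q) * indicator (carleson_tent a) (\<phi> z) * ennreal (\<omega> z) \<partial>?M)"
        using tent_sets by (intro nn_integral_pullback_measure u \<phi> \<omega>(1)) simp
      also have "\<dots> \<le> (\<integral>\<^sup>+ z. ennreal ((3 * Im a) powr m)
          * ennreal (norm (u z) powr q * norm (f (\<phi> z)) powr q * \<omega> z) \<partial>?M)"
      proof (rule nn_integral_mono)
        fix z assume "z \<in> space ?M"
        then have z: "z \<in> upper_half_plane" "\<phi> z \<in> upper_half_plane" "0 \<le> \<omega> z"
          using \<phi>(2) \<omega>(1) by (auto simp: is_weight_def)
        have "norm (u z) powr q * indicator (carleson_tent a) (\<phi> z) * \<omega> z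
            \<le> norm (u z) powr q * ((3 * Im a) powr m * norm (f (\<phi> z)) powr q) * \<omega> z"
          using indicator_carleson_tent_le[OF a m0, of "\<phi> z"] z
          by (intro mult_right_mono mult_left_mono) (auto simp: f_powr)
        then show "ennreal (norm (u z) powr q) * indicator (carleson_tent a) (\<phi> z) * ennreal (\<omega> z)
            \<le> ennreal ((3 * Im a) powr m) * ennreal (norm (u z) powr q * norm (f (\<phi> z)) powr q * \<omega> z)"
          using z by (simp add: ennreal_indicator[symmetric] ennreal_mult'[symmetric]
              ennreal_mult''[symmetric] ennreal_leI mult_ac)
      qed
      also have "\<dots> = ennreal ((3 * Im a) powr m)
          * (\<integral>\<^sup>+ z. ennreal (norm (u z) powr q * norm (f (\<phi> z)) powr q * \<omega> z) \<partial>?M)"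
      proof (rule nn_integral_cmult)
        have [measurable]: "(\<lambda>z. f (\<phi> z)) \<in> borel_measurable ?M"
          using f \<phi> by (intro borel_measurable_bergman_comp) (auto simp: bergman_space_def)
        have [measurable]: "u \<in> borel_measurable ?M"
          using u by (rule holomorphic_measurable_bergman)
        have [measurable]: "\<omega> \<in> borel_measurable ?M"
          using \<omega>(1) by (simp add: is_weight_def measurable_bergman_measure_cong)
        show "(\<lambda>z. ennreal (norm (u z) powr q * norm (f (\<phi> z)) powr q * \<omega> z)) \<in> borel_measurable ?M"
          by measurable
      qed
      also have "\<dots> \<le> ennreal ((3 * Im a) powr m) * (ennreal (C\<^sub>1 + C\<^sub>0) * b * ?N f)"
        unfolding b_def by (intro mult_left_mono main \<omega> f) simp
      also have "\<dots> = ennreal ((3 * Im a) powr m * Im a powr (\<alpha> + 2 - m)) * (ennreal (C\<^sub>1 + C\<^sub>0) * b * J)"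
        by (simp add: Nf ennreal_mult mult_ac)
      also have "(3 * Im a) powr m * Im a powr (\<alpha> + 2 - m) = Im a powr (\<alpha> + 2) * 3 powr m"
        using y by (simp add: powr_mult powr_diff)
      finally show ?thesis
        by (simp add: D_def ennreal_mult mult_ac)
    qed
    have "A \<le> (\<integral>\<^sup>+ z. ennreal (3 powr m) * ennreal (norm (z + \<i>) powr (- m)) \<partial>?M)"
      unfolding A_def emeasure_bergman_tent_eq_nn_integral
    proof (rule nn_integral_mono)
      fix z
      have "indicator (carleson_tent \<i>) z \<le> 3 powr m * norm (z + \<i>) powr (- m)"
        using indicator_carleson_tent_le[of \<i> m z] m0 by (simp add: upper_half_plane_def)
      then show "indicator (carleson_tent \<i>) z \<le> ennreal (3 powr m) * ennreal (norm (z + \<i>) powr (- m))"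
        by (simp add: ennreal_indicator[symmetric] ennreal_mult'[symmetric] ennreal_leI)
    qed
    also have "\<dots> = ennreal (3 powr m) * J"
      unfolding J_def
    by (rule nn_integral_cmult[OF borel_measurable_bergman_kernel])
    also have "\<dots> < \<infinity>"
      using J by (simp add: ennreal_mult_less_top)
    finally have A: "A < \<infinity>" .
    \<comment> \<open>The factor \<open>Im a powr (\<alpha> + 2)\<close> cancels in the quotient.\<close>
    have "(SUP a\<in>upper_half_plane. emeasure (pullback_measure u \<phi> q \<omega> \<alpha>) (carleson_tent a)
        / emeasure ?M (carleson_tent a)) \<le> D / A"
    proof (rule SUP_least)
      fix a assume a: "a \<in> upper_half_plane"
      then have y: "0 < Im a" by (simp add: upper_half_plane_def)
      have "A * (D / A) = D"
        using A A0 mult_divide_eq_ennreal[of A D] by (simp add: ennreal_times_divide mult.commute)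
      then have "emeasure (pullback_measure u \<phi> q \<omega> \<alpha>) (carleson_tent a)
          \<le> ennreal (Im a powr (\<alpha> + 2)) * (A * (D / A))"
        using tent[OF a] by simp
      also have "\<dots> = emeasure ?M (carleson_tent a) * (D / A)"
        unfolding emeasure_carleson_tent[OF a] A_def by (simp add: mult.assoc)
      finally show "emeasure (pullback_measure u \<phi> q \<omega> \<alpha>) (carleson_tent a) / emeasure ?M (carleson_tent a) \<le> D / A"
        using y A0 unfolding emeasure_carleson_tent[OF a] A_def
        by (intro divide_le_posI_ennreal) (auto simp: ennreal_zero_less_mult_iff)
    qed
    also have "\<dots> < \<infinity>"
      using D A0 by (auto simp: ennreal_divide_eq_top_iff less_top[symmetric])
    finally show ?thesis
      by (simp add: one_carleson_def pullback_measure_def)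
  qed
  show ?thesis
  proof (intro conjI exI[of _ "C\<^sub>1 + C\<^sub>0"] allI impI ballI)
    show "0 < C\<^sub>1 + C\<^sub>0"
      using C\<^sub>0(1) C\<^sub>1 by simp
  qed (use main carleson q in \<open>auto simp: bergman_norm_powr\<close>)
qed

end
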